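(* Let $m<n$ be positive integers. Then $f(\mathsf{A}_m)<f(\mathsf{A}_n)$. Consequently, $\mathrm{cod}(\mathsf{A}_m)\nsubseteq\mathrm{cod}(\mathsf{A}_{m+1})$.
   Context: $\mathsf{A}_m$ is the alternating group of degree $m$. For a finite group $X$, $\mathrm{Irr}(X)$ is the set of complex irreducible characters of $X$, $b(X)$ is the largest degree of a character in $\mathrm{Irr}(X)$, and $f(X)=|X|/b(X)$. The codegree of $\chi\in\mathrm{Irr}(X)$ is $\mathrm{cod}(\chi)=|X:\ker(\chi)|/\chi(1)$, and $\mathrm{cod}(X)=\{\mathrm{cod}(\chi):\chi\in\mathrm{Irr}(X)\}$.
   Formalization: The inequality f(A_m)<f(A_n) excludes only (m,n)=(1,2), where both groups are trivial and f=1; the claim cod(A_m) not contained in cod(A_{m+1}) excludes only m=1,2,3, where containment holds ({1}, {1}, {1,3}, {1,3,4}). *)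

theory Defs
  imports "HOL-Algebra.Sym_Groups" "HOL-Algebra.Coset" "Jordan_Normal_Form.VS_Connect"
begin

(* The last argument of ring_mat only fills the record extension and plays no role. *)
definition GL :: "nat \<Rightarrow> complex mat monoid" where
  "GL d = units_of (ring_mat TYPE(complex) d ())"

definition representation :: "('a, 'b) monoid_scheme \<Rightarrow> nat \<Rightarrow> ('a \<Rightarrow> complex mat) \<Rightarrow> bool" where
  "representation G d \<rho> \<longleftrightarrow> \<rho> \<in> hom G (GL d)"

definition invariant_subspace ::
  "('a, 'b) monoid_scheme \<Rightarrow> nat \<Rightarrow> ('a \<Rightarrow> complex mat) \<Rightarrow> complex vec set \<Rightarrow> bool" where
  "invariant_subspace G d \<rho> W \<longleftrightarrow>
     VectorSpace.subspace class_ring W (module_vec TYPE(complex) d) \<and>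
     (\<forall>g\<in>carrier G. \<forall>w\<in>W. \<rho> g *\<^sub>v w \<in> W)"

definition irreducible_representation ::
  "('a, 'b) monoid_scheme \<Rightarrow> nat \<Rightarrow> ('a \<Rightarrow> complex mat) \<Rightarrow> bool" where
  "irreducible_representation G d \<rho> \<longleftrightarrow>
     representation G d \<rho> \<and> 0 < d \<and>
     (\<forall>W. invariant_subspace G d \<rho> W \<longrightarrow> W = {0\<^sub>v d} \<or> W = carrier_vec d)"

(* Restricting to the carrier makes a character determined by its values on G, so that Irr G is
   really the set of irreducible characters: off the carrier, elements of the type 'a are
   irrelevant. *)
definition character_of ::
  "('a, 'b) monoid_scheme \<Rightarrow> nat \<Rightarrow> ('a \<Rightarrow> complex mat) \<Rightarrow> 'a \<Rightarrow> complex" where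
  "character_of G d \<rho> = (\<lambda>g\<in>carrier G. \<Sum>i<d. \<rho> g $$ (i, i))"

definition Irr :: "('a, 'b) monoid_scheme \<Rightarrow> ('a \<Rightarrow> complex) set" where
  "Irr G = {character_of G d \<rho> |d \<rho>. irreducible_representation G d \<rho>}"

(* The value of a character at the identity is the dimension of the representation, so taking
   the real part only changes the type. *)
definition character_degree :: "('a, 'b) monoid_scheme \<Rightarrow> ('a \<Rightarrow> complex) \<Rightarrow> real" where
  "character_degree G \<chi> = Re (\<chi> \<one>\<^bsub>G\<^esub>)"

definition character_kernel :: "('a, 'b) monoid_scheme \<Rightarrow> ('a \<Rightarrow> complex) \<Rightarrow> 'a set" where
  "character_kernel G \<chi> = {g \<in> carrier G. \<chi> g = \<chi> \<one>\<^bsub>G\<^esub>}"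

(* Irr G is finite and nonempty for finite G, so that Max is a genuine maximum there. *)
definition max_degree :: "('a, 'b) monoid_scheme \<Rightarrow> real" where
  "max_degree G = Max (character_degree G ` Irr G)"

definition order_over_max_degree :: "('a, 'b) monoid_scheme \<Rightarrow> real" where
  "order_over_max_degree G = real (card (carrier G)) / max_degree G"

definition codegree :: "('a, 'b) monoid_scheme \<Rightarrow> ('a \<Rightarrow> complex) \<Rightarrow> real" where
  "codegree G \<chi> = real (card (rcosets\<^bsub>G\<^esub> (character_kernel G \<chi>))) / character_degree G \<chi>"

definition codegrees :: "('a, 'b) monoid_scheme \<Rightarrow> real set" where
  "codegrees G = codegree G ` Irr G"

end

theory Submission
  imports Defs "Jordan_Normal_Form.Spectral_Radius" "Jordan_Normal_Form.Schur_Decomposition"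
    "HOL-Algebra.Multiplicative_Group"
begin

text \<open>For a subgroup \<open>H\<close> of a finite group \<open>G\<close>, an irreducible representation of \<open>G\<close> is spanned by
  the translates of any irreducible \<open>H\<close>-submodule, so \<open>b(G) \<le> |G : H| b(H)\<close>. Equality would mean
  that an irreducible character of degree \<open>b(G)\<close> is induced from each of its constituents over \<open>H\<close>.
  Then each class sum and its part in \<open>H\<close> have the same trace, which makes the character vanish
  on all conjugacy classes not contained in \<open>H\<close>. If \<open>H\<close> has trivial core, these are all
  nontrivial classes, and only the trivial group has an irreducible character vanishing there.
  With \<open>H = A\<^sub>n\<close> in \<open>A\<^sub>n\<^sub>+\<^sub>1\<close> this gives \<open>f(A\<^sub>n) < f(A\<^sub>n\<^sub>+\<^sub>1)\<close>.

  For \<open>m \<ge> 4\<close>, a nontrivial character of maximal degree of \<open>A\<^sub>m\<close> has a codegree strictly between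
  \<open>1\<close> and \<open>f(A\<^sub>m\<^sub>+\<^sub>1)\<close>, whereas simplicity of \<open>A\<^sub>m\<^sub>+\<^sub>1\<close> makes its nontrivial characters faithful, with
  codegrees at least \<open>f(A\<^sub>m\<^sub>+\<^sub>1)\<close>.\<close>

section \<open>Linear algebra\<close>

text \<open>Neither orthogonality of characters nor complete reducibility enters. Spanning by
  translates bounds a dimension, and equality in that bound means that the translates form a direct
  sum, so that the component belonging to H can be read off from a vanishing sum over the group. The
  comparison of traces rests on this extraction. Applied to a line fixed by the kernel of a
  nontrivial irreducible character, in place of an H-submodule, the same count gives \<chi>(1) < |G
  : ker \<chi>|, which is why its codegree exceeds 1.

  An irreducible character that vanishes off the identity is excluded by the operator sum of all
  \<open>\<rho> g\<close>: its trace would be the degree, so the operator is nonzero; its values are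
  fixed vectors, and by irreducibility a nonzero fixed vector makes the representation trivial.

  Kernels are defined through character values, so a trace argument is needed to see that they are
  normal subgroups, which is what simplicity is about.\<close>

lemma mult_mat_vec_index_sum:
  assumes "A \<in> carrier_mat n m" "v \<in> carrier_vec m" "i < n"
  shows "(A *\<^sub>v v) $ i = (\<Sum>j<m. A $$ (i, j) * v $ j)"
  using assms by (auto simp: scalar_prod_def atLeast0LessThan)

text \<open>Formed componentwise because vectors of different dimensions have different zeros;
  \<open>d\<close> fixes the value of the empty sum.\<close>

definition vsum :: "nat \<Rightarrow> 'i set \<Rightarrow> ('i \<Rightarrow> complex vec) \<Rightarrow> complex vec" where
  "vsum d I f = vec d (\<lambda>r. \<Sum>i\<in>I. f i $ r)"

lemma vsum_carrier [simp]: "vsum d I f \<in> carrier_vec d"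
  by (simp add: vsum_def)

lemma vsum_index [simp]: "r < d \<Longrightarrow> vsum d I f $ r = (\<Sum>i\<in>I. f i $ r)"
  by (simp add: vsum_def)

lemma vsum_dim [simp]: "dim_vec (vsum d I f) = d"
  by (simp add: vsum_def)

lemma vsum_cong: "I = J \<Longrightarrow> (\<And>i. i \<in> J \<Longrightarrow> f i = g i) \<Longrightarrow> vsum d I f = vsum d J g"
  by (auto simp: vsum_def)

lemma vsum_reindex: "inj_on h I \<Longrightarrow> vsum d (h ` I) f = vsum d I (\<lambda>i. f (h i))"
  by (simp add: vsum_def sum.reindex)

lemma vsum_Sigma:
  assumes "finite I" "finite J"
  shows "vsum d (I \<times> J) f = vsum d I (\<lambda>i. vsum d J (\<lambda>j. f (i, j)))"
  by (rule eq_vecI) (auto simp: sum.cartesian_product)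

lemma mult_mat_vec_vsum:
  assumes A: "A \<in> carrier_mat n m" and f: "\<And>i. i \<in> I \<Longrightarrow> f i \<in> carrier_vec m"
  shows "A *\<^sub>v vsum m I f = vsum n I (\<lambda>i. A *\<^sub>v f i)"
proof (rule eq_vecI)
  fix r assume "r < dim_vec (vsum n I (\<lambda>i. A *\<^sub>v f i))"
  then have r: "r < n" by simp
  have "(A *\<^sub>v vsum m I f) $ r = (\<Sum>j<m. \<Sum>i\<in>I. A $$ (r, j) * f i $ j)"
    by (subst mult_mat_vec_index_sum[OF A _ r]) (auto simp: sum_distrib_left)
  also have "\<dots> = (\<Sum>i\<in>I. (A *\<^sub>v f i) $ r)"
    by (subst sum.swap) (auto intro!: sum.cong simp: mult_mat_vec_index_sum[OF A f r])
  finally show "(A *\<^sub>v vsum m I f) $ r = vsum n I (\<lambda>i. A *\<^sub>v f i) $ r"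
    using r by simp
qed (use A in auto)

section \<open>Linear subspaces and their bases\<close>

definition lin_subspace :: "nat \<Rightarrow> complex vec set \<Rightarrow> bool" where
  "lin_subspace d W \<longleftrightarrow> W \<subseteq> carrier_vec d \<and> 0\<^sub>v d \<in> W \<and>
     (\<forall>v\<in>W. \<forall>w\<in>W. v + w \<in> W) \<and> (\<forall>c. \<forall>v\<in>W. c \<cdot>\<^sub>v v \<in> W)"

text \<open>Bridge from the library notion of subspace, which occurs in the definition of
  irreducibility, to bare closure conditions; all later arguments use the latter.\<close>

lemma subspace_iff_lin_subspace:
  "VectorSpace.subspace class_ring W (module_vec TYPE(complex) d) \<longleftrightarrow> lin_subspace d W"
proof -
  interpret vec_space "TYPE(complex)" d .
  show ?thesis
  proof
    assume "VectorSpace.subspace class_ring W (module_vec TYPE(complex) d)"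
    then have s: "submodule class_ring W (module_vec TYPE(complex) d)"
      by (simp add: VectorSpace.subspace_def)
    then show "lin_subspace d W"
      using submodule.m_closed[OF s] submodule.zero_closed[OF s] submodule.smult_closed[OF s]
        submodule.subset[OF s]
      by (auto simp: lin_subspace_def module_vec_simps)
  next
    assume "lin_subspace d W"
    then show "VectorSpace.subspace class_ring W (module_vec TYPE(complex) d)"
      unfolding VectorSpace.subspace_def submodule_def lin_subspace_def
      using vec_vs vec_module
      by (auto simp: module_vec_simps class_ring_simps)
  qed
qed

lemma lin_subspace_vsum:
  assumes W: "lin_subspace d W" and f: "\<And>i. i \<in> I \<Longrightarrow> f i \<in> W"
  shows "vsum d I f \<in> W"
  using f
proof (induction I rule: infinite_finite_induct)
  case (infinite I)
  then have "vsum d I f = 0\<^sub>v d" by (auto simp: vsum_def)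
  then show ?case using W by (simp add: lin_subspace_def)
next
  case empty
  have "vsum d {} f = 0\<^sub>v d" by (auto simp: vsum_def)
  then show ?case using W by (simp add: lin_subspace_def)
next
  case (insert i I)
  have "f i \<in> carrier_vec d" using W insert by (auto simp: lin_subspace_def)
  then have "vsum d (insert i I) f = f i + vsum d I f"
    using insert by (intro eq_vecI) auto
  then show ?case using W insert by (auto simp: lin_subspace_def)
qed

text \<open>A subspace is handled through a matrix whose columns form a basis: independence of the
  columns is injectivity, and their span is \<open>mat_range\<close>. A subrepresentation then is an
  injective intertwiner \<open>B\<close> with \<open>\<rho> g * B = B * \<sigma> g\<close>.\<close>

definition injective_mat :: "complex mat \<Rightarrow> bool" where
  "injective_mat B \<longleftrightarrow>
     (\<forall>x\<in>carrier_vec (dim_col B). B *\<^sub>v x = 0\<^sub>v (dim_row B) \<longrightarrow> x = 0\<^sub>v (dim_col B))"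

definition mat_range :: "complex mat \<Rightarrow> complex vec set" where
  "mat_range B = {B *\<^sub>v x |x. x \<in> carrier_vec (dim_col B)}"

lemma mat_range_iff:
  "B \<in> carrier_mat d k \<Longrightarrow> w \<in> mat_range B \<longleftrightarrow> (\<exists>x\<in>carrier_vec k. w = B *\<^sub>v x)"
  by (auto simp: mat_range_def)

lemma lin_subspace_mat_range:
  assumes B: "B \<in> carrier_mat d k"
  shows "lin_subspace d (mat_range B)"
  unfolding lin_subspace_def
proof (intro conjI ballI allI)
  show "mat_range B \<subseteq> carrier_vec d" using B by (auto simp: mat_range_iff)
  show "0\<^sub>v d \<in> mat_range B"
    unfolding mat_range_iff[OF B] by (rule bexI[of _ "0\<^sub>v k"]) (use B in auto)
next
  fix v w assume "v \<in> mat_range B" "w \<in> mat_range B"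
  then obtain x y where "x \<in> carrier_vec k" "y \<in> carrier_vec k" "v = B *\<^sub>v x" "w = B *\<^sub>v y"
    using B by (auto simp: mat_range_iff)
  then show "v + w \<in> mat_range B"
    unfolding mat_range_iff[OF B]
    by (intro bexI[of _ "x + y"]) (auto simp: mult_add_distrib_mat_vec[OF B])
next
  fix c v assume "v \<in> mat_range B"
  then obtain x where "x \<in> carrier_vec k" "v = B *\<^sub>v x"
    using B by (auto simp: mat_range_iff)
  then show "c \<cdot>\<^sub>v v \<in> mat_range B"
    unfolding mat_range_iff[OF B]
    by (intro bexI[of _ "c \<cdot>\<^sub>v x"]) (auto simp: mult_mat_vec[OF B])
qed

lemma injective_matD:
  assumes "injective_mat B" "B \<in> carrier_mat d k" "x \<in> carrier_vec k" "B *\<^sub>v x = 0\<^sub>v d"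
  shows "x = 0\<^sub>v k"
  using assms by (auto simp: injective_mat_def)

lemma injective_mat_eqD:
  assumes B: "injective_mat B" "B \<in> carrier_mat d k"
    and xy: "x \<in> carrier_vec k" "y \<in> carrier_vec k" "B *\<^sub>v x = B *\<^sub>v y"
  shows "x = y"
proof -
  have "B *\<^sub>v (x - y) = 0\<^sub>v d"
    using B xy by (simp add: mult_minus_distrib_mat_vec[OF B(2)])
  then have "x - y = 0\<^sub>v k" using injective_matD[OF B, of "x - y"] xy by simp
  then show ?thesis using xy
    by (metis (no_types, lifting) carrier_vecD eq_vecI index_minus_vec(1) index_zero_vec(1) right_minus_eq)
qed

lemma injective_mat_mult:
  assumes "injective_mat A" "A \<in> carrier_mat d k" "injective_mat B" "B \<in> carrier_mat k l"
  shows "injective_mat (A * B)"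
  using assms unfolding injective_mat_def
  by (auto simp: assoc_mult_mat_vec[of A d k B l])

section \<open>Dimension counting with injective and surjective matrices\<close>

lemma injective_square_mat_surj:
  assumes B: "injective_mat B" "B \<in> carrier_mat d d" and y: "y \<in> carrier_vec d"
  shows "y \<in> mat_range B"
proof -
  have "det B \<noteq> 0"
    using injective_matD[OF B] det_0_iff_vec_prod_zero_field[OF B(2)] by auto
  from det_non_zero_imp_unit[OF B(2) this, of "()"]
  obtain C where C: "C \<in> carrier_mat d d" "B * C = 1\<^sub>m d"
    by (auto simp: Units_def ring_mat_def)
  have "B *\<^sub>v (C *\<^sub>v y) = y"
    using C y B by (simp flip: assoc_mult_mat_vec[of B d d C d])
  then show ?thesis using C y B by (auto simp: mat_range_iff intro!: bexI[of _ "C *\<^sub>v y"])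
qed

text \<open>If there were more columns than rows, padding with zero rows would give an injective
  square matrix, hence a surjective one; but row \<open>d\<close> is already zero, which keeps
  \<open>unit_vec k d\<close> out of the range.\<close>

lemma injective_mat_dim_le:
  assumes B: "injective_mat B" "B \<in> carrier_mat d k"
  shows "k \<le> d"
proof (rule ccontr)
  assume "\<not> k \<le> d"
  then have dk: "d < k" by simp
  define C where "C = mat k k (\<lambda>(i, j). if i < d then B $$ (i, j) else 0)"
  have C: "C \<in> carrier_mat k k" by (simp add: C_def)
  have Cx: "(C *\<^sub>v x) $ i = (if i < d then (B *\<^sub>v x) $ i else 0)"
    if "x \<in> carrier_vec k" "i < k" for x i
  proof -
    have "C $$ (i, j) = (if i < d then B $$ (i, j) else 0)" if "j < k" for j
      using that \<open>i < k\<close> by (simp add: C_def)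
    then show ?thesis
      using that dk by (simp add: mult_mat_vec_index_sum[OF C] mult_mat_vec_index_sum[OF B(2)]
          del: index_mult_mat_vec)
  qed
  have "injective_mat C"
    unfolding injective_mat_def
  proof (intro ballI impI)
    fix x assume x: "x \<in> carrier_vec (dim_col C)" "C *\<^sub>v x = 0\<^sub>v (dim_row C)"
    then have xk: "x \<in> carrier_vec k" using C by simp
    have "B *\<^sub>v x = 0\<^sub>v d"
    proof (rule eq_vecI)
      fix i assume "i < dim_vec (0\<^sub>v d :: complex vec)"
      then show "(B *\<^sub>v x) $ i = 0\<^sub>v d $ i" using Cx[OF xk, of i] x(2) C dk by auto
    qed (use B in auto)
    then show "x = 0\<^sub>v (dim_col C)" using injective_matD[OF B xk] C by simp
  qed
  from injective_square_mat_surj[OF this C, of "unit_vec k d"]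
  obtain x where "x \<in> carrier_vec k" "unit_vec k d = C *\<^sub>v x"
    using C dk by (auto simp: mat_range_iff)
  then have "unit_vec k d $ d = (0 :: complex)" using Cx[of x d] dk by simp
  then show False using dk by simp
qed

text \<open>Preimages of the unit vectors are the columns of a right inverse \<open>X\<close>. It is
  injective, so the bound for injective matrices applies to it. In the square case \<open>X\<close>
  is also a left inverse.\<close>

lemma surjective_mat_dim:
  assumes A: "A \<in> carrier_mat d n" and surj: "carrier_vec d \<subseteq> mat_range A"
  shows "d \<le> n" and "d = n \<Longrightarrow> injective_mat A"
proof -
  have "\<forall>i. \<exists>x. i < d \<longrightarrow> x \<in> carrier_vec n \<and> A *\<^sub>v x = unit_vec d i"
    using surj A by (metis mat_range_iff subsetD unit_vec_carrier)
  then obtain x where x: "\<And>i. i < d \<Longrightarrow> x i \<in> carrier_vec n \<and> A *\<^sub>v x i = unit_vec d i"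
    by metis
  define X where "X = mat n d (\<lambda>(i, j). x j $ i)"
  have X: "X \<in> carrier_mat n d" by (simp add: X_def)
  have colX: "col X j = x j" if "j < d" for j
    using that x[OF that] by (intro eq_vecI) (auto simp: X_def)
  have AX: "A * X = 1\<^sub>m d"
  proof (rule eq_matI)
    fix i j assume ij: "i < dim_row (1\<^sub>m d :: complex mat)" "j < dim_col (1\<^sub>m d :: complex mat)"
    then have "(A * X) $$ (i, j) = (A *\<^sub>v x j) $ i"
      using A X colX by simp
    then show "(A * X) $$ (i, j) = 1\<^sub>m d $$ (i, j)" using ij x[of j] by (simp add: unit_vec_def)
  qed (use A X in auto)
  have "injective_mat X"
    unfolding injective_mat_def
  proof (intro ballI impI)
    fix y assume y: "y \<in> carrier_vec (dim_col X)" "X *\<^sub>v y = 0\<^sub>v (dim_row X)"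
    then have "y = A *\<^sub>v (X *\<^sub>v y)"
      using assoc_mult_mat_vec[OF A X, of y] X AX by simp
    then show "y = 0\<^sub>v (dim_col X)" using y A X by auto
  qed
  then show "d \<le> n" using injective_mat_dim_le X by blast
  assume dn: "d = n"
  have XA: "X * A = 1\<^sub>m d" using mat_mult_left_right_inverse[of A d X] A X AX dn by simp
  show "injective_mat A"
    unfolding injective_mat_def
  proof (intro ballI impI)
    fix y assume y: "y \<in> carrier_vec (dim_col A)" "A *\<^sub>v y = 0\<^sub>v (dim_row A)"
    then have "y = X *\<^sub>v (A *\<^sub>v y)"
      using assoc_mult_mat_vec[OF X A, of y] A XA dn by simp
    then show "y = 0\<^sub>v (dim_col A)" using y A X dn by auto
  qed
qed

text \<open>The family, enumerated, forms the columns of a matrix that is surjective because the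
  family spans. The second part, independence of a spanning family with exactly \<open>d\<close>
  members, is what later turns an equality of dimensions into a direct sum.\<close>

lemma spanning_family_dim:
  assumes I: "finite I" and a: "\<And>i. i \<in> I \<Longrightarrow> a i \<in> carrier_vec d"
    and span: "\<And>v. v \<in> carrier_vec d \<Longrightarrow> \<exists>x. v = vsum d I (\<lambda>i. x i \<cdot>\<^sub>v a i)"
  shows "d \<le> card I"
    and "d = card I \<Longrightarrow> vsum d I (\<lambda>i. x i \<cdot>\<^sub>v a i) = 0\<^sub>v d \<Longrightarrow> i \<in> I \<Longrightarrow> x i = 0"
proof -
  define n where "n = card I"
  obtain e where e: "bij_betw e {..<n} I"
    using ex_bij_betw_nat_finite[OF I] by (auto simp: n_def atLeast0LessThan)
  define A where "A = mat d n (\<lambda>(r, j). a (e j) $ r)"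
  have A: "A \<in> carrier_mat d n" by (simp add: A_def)
  have Ax: "A *\<^sub>v vec n (\<lambda>j. x (e j)) = vsum d I (\<lambda>i. x i \<cdot>\<^sub>v a i)" for x
  proof (rule eq_vecI)
    fix r assume "r < dim_vec (vsum d I (\<lambda>i. x i \<cdot>\<^sub>v a i))"
    then have r: "r < d" by simp
    have "(A *\<^sub>v vec n (\<lambda>j. x (e j))) $ r = (\<Sum>j<n. x (e j) * a (e j) $ r)"
      using r by (subst mult_mat_vec_index_sum[OF A]) (auto simp: A_def mult.commute)
    also have "\<dots> = (\<Sum>i\<in>I. x i * a i $ r)"
      by (rule sum.reindex_bij_betw[OF e])
    also have "\<dots> = vsum d I (\<lambda>i. x i \<cdot>\<^sub>v a i) $ r"
      using r carrier_vecD[OF a] by (auto intro!: sum.cong)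
    finally show "(A *\<^sub>v vec n (\<lambda>j. x (e j))) $ r = vsum d I (\<lambda>i. x i \<cdot>\<^sub>v a i) $ r" .
  qed (use A in auto)
  have surj: "carrier_vec d \<subseteq> mat_range A"
  proof
    fix v :: "complex vec" assume "v \<in> carrier_vec d"
    from span[OF this] obtain x where "v = vsum d I (\<lambda>i. x i \<cdot>\<^sub>v a i)" by blast
    then show "v \<in> mat_range A" unfolding mat_range_iff[OF A] Ax[symmetric] by auto
  qed
  show "d \<le> card I" using surjective_mat_dim(1)[OF A surj] by (simp add: n_def)
  assume d: "d = card I" and 0: "vsum d I (\<lambda>i. x i \<cdot>\<^sub>v a i) = 0\<^sub>v d" and i: "i \<in> I"
  have "injective_mat A" using surjective_mat_dim(2)[OF A surj] d by (simp add: n_def)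
  from injective_matD[OF this A _ 0[folded Ax]]
  have *: "vec n (\<lambda>j. x (e j)) = 0\<^sub>v n" by simp
  from i e obtain j where "j < n" "i = e j" by (auto simp: bij_betw_def)
  with arg_cong[OF *, of "\<lambda>v. v $ j"] show "x i = 0" by simp
qed

text \<open>An injective matrix with the most columns among those with range inside \<open>W\<close>
  has range \<open>W\<close>: a vector of \<open>W\<close> outside the range could be appended as a
  further column. The number of columns is bounded by \<open>d\<close>, and the matrix without
  columns shows that there is a candidate.\<close>

lemma subspace_basis_mat:
  assumes W: "lin_subspace d W" and nz: "W \<noteq> {0\<^sub>v d}"
  obtains B k where "B \<in> carrier_mat d k" "injective_mat B" "0 < k" "mat_range B = W"
proof -
  define P where "P k \<longleftrightarrow> (\<exists>B\<in>carrier_mat d k. injective_mat B \<and> mat_range B \<subseteq> W)" for k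
  have P0: "P 0"
    unfolding P_def
  proof (intro bexI conjI)
    show "injective_mat (0\<^sub>m d 0)" by (auto simp: injective_mat_def)
    have "0\<^sub>m d 0 *\<^sub>v x = 0\<^sub>v d" if "x \<in> carrier_vec 0" for x :: "complex vec"
      using that by (intro eq_vecI) (auto simp: scalar_prod_def)
    then show "mat_range (0\<^sub>m d 0) \<subseteq> W" using W by (auto simp: mat_range_def lin_subspace_def)
  qed auto
  have bnd: "k \<le> d" if "P k" for k using that injective_mat_dim_le by (auto simp: P_def)
  define k where "k = (GREATEST k. P k)"
  have Pk: "P k" unfolding k_def by (rule GreatestI_nat[of P 0 d]) (use P0 bnd in auto)
  then obtain B where B: "B \<in> carrier_mat d k" "injective_mat B" "mat_range B \<subseteq> W"
    by (auto simp: P_def)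
  have "W \<subseteq> mat_range B"
  proof (rule ccontr)
    assume "\<not> W \<subseteq> mat_range B"
    then obtain w where w: "w \<in> W" "w \<notin> mat_range B" by auto
    have wd: "w \<in> carrier_vec d" using w W by (auto simp: lin_subspace_def)
    define C where "C = mat d (Suc k) (\<lambda>(i, j). if j < k then B $$ (i, j) else w $ i)"
    have C: "C \<in> carrier_mat d (Suc k)" by (simp add: C_def)
    define cut where "cut x = vec k (($) x)" for x :: "complex vec"
    have Cx: "C *\<^sub>v x = B *\<^sub>v cut x + x $ k \<cdot>\<^sub>v w" if x: "x \<in> carrier_vec (Suc k)" for x
    proof (rule eq_vecI)
      fix i assume "i < dim_vec (B *\<^sub>v cut x + x $ k \<cdot>\<^sub>v w)"
      then have i: "i < d" using wd by simp
      have "C $$ (i, j) = (if j < k then B $$ (i, j) else w $ i)" if "j < Suc k" for j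
        using that i by (simp add: C_def)
      then show "(C *\<^sub>v x) $ i = (B *\<^sub>v cut x + x $ k \<cdot>\<^sub>v w) $ i"
        using i wd B(1)
        by (simp add: mult_mat_vec_index_sum[OF C x] mult_mat_vec_index_sum[OF B(1)] cut_def
            del: index_mult_mat_vec)
    qed (use wd C in auto)
    have "injective_mat C"
      unfolding injective_mat_def
    proof (intro ballI impI)
      fix x assume "x \<in> carrier_vec (dim_col C)" and x0: "C *\<^sub>v x = 0\<^sub>v (dim_row C)"
      then have x: "x \<in> carrier_vec (Suc k)" using C by simp
      have cut: "cut x \<in> carrier_vec k" by (simp add: cut_def)
      have z: "B *\<^sub>v cut x + x $ k \<cdot>\<^sub>v w = 0\<^sub>v d" using Cx[OF x] x0 C by simp
      \<comment> \<open>A nonzero coefficient of the appended column would express \<open>w\<close>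
        through the columns of \<open>B\<close>.\<close>
      have "x $ k = 0"
      proof (rule ccontr)
        assume nz: "x $ k \<noteq> 0"
        have "w = B *\<^sub>v ((- 1 / x $ k) \<cdot>\<^sub>v cut x)"
        proof (rule eq_vecI)
          fix i assume "i < dim_vec (B *\<^sub>v ((- 1 / x $ k) \<cdot>\<^sub>v cut x))"
          then have i: "i < d" using B by simp
          have "(B *\<^sub>v cut x) $ i + x $ k * w $ i = 0"
            using arg_cong[OF z, of "\<lambda>v. v $ i"] i wd B(1) by simp
          then have "(B *\<^sub>v cut x) $ i = - (x $ k * w $ i)" by (simp add: eq_neg_iff_add_eq_0)
          then have "((- 1 / x $ k) \<cdot>\<^sub>v (B *\<^sub>v cut x)) $ i = w $ i" using nz i B(1)
            by (simp del: index_mult_mat_vec)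
          then show "w $ i = (B *\<^sub>v ((- 1 / x $ k) \<cdot>\<^sub>v cut x)) $ i"
            by (simp add: mult_mat_vec[OF B(1) cut])
        qed (use wd B in auto)
        with w(2) cut show False unfolding mat_range_iff[OF B(1)] by (auto intro!: bexI)
      qed
      moreover have "0 \<cdot>\<^sub>v w = 0\<^sub>v d" using wd by (intro eq_vecI) auto
      ultimately have "B *\<^sub>v cut x = 0\<^sub>v d" using z B(1) cut by simp
      then have "cut x = 0\<^sub>v k" using injective_matD[OF B(2,1) cut] by simp
      then have "x $ i = 0" if "i < k" for i
        using that by (metis cut_def index_vec index_zero_vec(1))
      with \<open>x $ k = 0\<close> have "x $ i = 0" if "i < Suc k" for i
        using that by (cases "i = k") auto
      then show "x = 0\<^sub>v (dim_col C)" using x C by (intro eq_vecI) auto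
    qed
    moreover have "mat_range C \<subseteq> W"
    proof
      fix v assume "v \<in> mat_range C"
      then obtain x where x: "x \<in> carrier_vec (Suc k)" "v = C *\<^sub>v x" using C by (auto simp: mat_range_iff)
      have "B *\<^sub>v cut x \<in> mat_range B"
        unfolding mat_range_iff[OF B(1)] by (rule bexI[of _ "cut x"]) (auto simp: cut_def)
      then have "B *\<^sub>v cut x \<in> W" using B(3) by auto
      then show "v \<in> W" using x Cx W w by (auto simp: lin_subspace_def)
    qed
    ultimately have "P (Suc k)" using C by (auto simp: P_def)
    then have "Suc k \<le> k" unfolding k_def by (rule Greatest_le_nat[of P _ d]) (use bnd in auto)
    then show False by simp
  qed
  with B have eq: "mat_range B = W" by auto
  have "0 < k"
  proof (rule ccontr)
    assume "\<not> 0 < k"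
    then have "B *\<^sub>v x = 0\<^sub>v d" if "x \<in> carrier_vec k" for x
      using that B by (intro eq_vecI) (auto simp: scalar_prod_def)
    then have "mat_range B \<subseteq> {0\<^sub>v d}" using B by (auto simp: mat_range_iff)
    with eq nz W show False by (auto simp: lin_subspace_def)
  qed
  with B eq that show thesis by blast
qed

section \<open>Eigenvalues, invariant subspaces and traces\<close>

lemma eigenvalue_exists:
  assumes "(A :: complex mat) \<in> carrier_mat n n" "0 < n"
  obtains c v where "v \<in> carrier_vec n" "v \<noteq> 0\<^sub>v n" "A *\<^sub>v v = c \<cdot>\<^sub>v v"
  using spectrum_non_empty[OF assms] assms
  by (auto simp: spectrum_def eigenvalue_def eigenvector_def)

text \<open>Column j of \<open>M\<close> holds the coordinates, in the basis given by
  \<open>B\<close>, of the image of column j of \<open>B\<close>: \<open>M\<close> is the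
  restriction of \<open>A\<close> to the subspace.\<close>

lemma mat_restrict:
  assumes A: "A \<in> carrier_mat d d" and B: "B \<in> carrier_mat d k" "injective_mat B"
    and inv: "\<And>w. w \<in> mat_range B \<Longrightarrow> A *\<^sub>v w \<in> mat_range B"
  shows "\<exists>M\<in>carrier_mat k k. A * B = B * M"
proof -
  have "\<exists>x. j < k \<longrightarrow> x \<in> carrier_vec k \<and> A *\<^sub>v col B j = B *\<^sub>v x" for j
  proof (cases "j < k")
    case True
    have "col B j = B *\<^sub>v unit_vec k j" using True B by (intro eq_vecI) auto
    then have "col B j \<in> mat_range B" using B by (auto simp: mat_range_iff)
    from inv[OF this] show ?thesis using B by (auto simp: mat_range_iff)
  qed auto
  then obtain x where x: "\<And>j. j < k \<Longrightarrow> x j \<in> carrier_vec k \<and> A *\<^sub>v col B j = B *\<^sub>v x j"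
    by metis
  define M where "M = mat k k (\<lambda>(i, j). x j $ i)"
  have M: "M \<in> carrier_mat k k" by (simp add: M_def)
  have colM: "col M j = x j" if "j < k" for j
    using that x[OF that] by (intro eq_vecI) (auto simp: M_def)
  have "A * B = B * M"
  proof (rule eq_matI)
    fix i j assume ij: "i < dim_row (B * M)" "j < dim_col (B * M)"
    then have "(A * B) $$ (i, j) = (A *\<^sub>v col B j) $ i" "(B * M) $$ (i, j) = (B *\<^sub>v x j) $ i"
      using A B M colM by auto
    then show "(A * B) $$ (i, j) = (B * M) $$ (i, j)" using x[of j] ij M by simp
  qed (use A B M in auto)
  with M show ?thesis by blast
qed

lemma eigenvector_in_subspace:
  assumes A: "A \<in> carrier_mat d d" and W: "lin_subspace d W" "W \<noteq> {0\<^sub>v d}"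
    and inv: "\<And>w. w \<in> W \<Longrightarrow> A *\<^sub>v w \<in> W"
  obtains c v where "v \<in> W" "v \<noteq> 0\<^sub>v d" "A *\<^sub>v v = c \<cdot>\<^sub>v v"
proof -
  obtain B k where B: "B \<in> carrier_mat d k" "injective_mat B" "0 < k" "mat_range B = W"
    using subspace_basis_mat[OF W] .
  obtain M where M: "M \<in> carrier_mat k k" "A * B = B * M"
    using mat_restrict[OF A B(1,2)] inv B(4) by blast
  obtain c v where v: "v \<in> carrier_vec k" "v \<noteq> 0\<^sub>v k" "M *\<^sub>v v = c \<cdot>\<^sub>v v"
    using eigenvalue_exists[OF M(1) B(3)] .
  have "A *\<^sub>v (B *\<^sub>v v) = B *\<^sub>v (M *\<^sub>v v)"
    using A B M v by (simp flip: assoc_mult_mat_vec[of A d d B k] assoc_mult_mat_vec[of B d k M k])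
  then have "A *\<^sub>v (B *\<^sub>v v) = c \<cdot>\<^sub>v (B *\<^sub>v v)" using v by (simp add: mult_mat_vec[OF B(1) v(1)])
  moreover have "B *\<^sub>v v \<in> W" using B v by (auto simp: mat_range_def)
  moreover have "B *\<^sub>v v \<noteq> 0\<^sub>v d" using injective_matD[OF B(2,1) v(1)] v by auto
  ultimately show thesis using that by blast
qed

definition mat_trace :: "complex mat \<Rightarrow> complex" where
  "mat_trace A = (\<Sum>i<dim_row A. A $$ (i, i))"

lemma mat_trace_mult_comm:
  assumes "A \<in> carrier_mat n m" "B \<in> carrier_mat m n"
  shows "mat_trace (A * B) = mat_trace (B * A)"
proof -
  have "mat_trace (A * B) = (\<Sum>i<n. \<Sum>j<m. A $$ (i, j) * B $$ (j, i))"
    using assms by (auto simp: mat_trace_def scalar_prod_def atLeast0LessThan intro!: sum.cong)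
  also have "\<dots> = (\<Sum>j<m. \<Sum>i<n. B $$ (j, i) * A $$ (i, j))"
    by (subst sum.swap) (simp add: mult.commute)
  also have "\<dots> = mat_trace (B * A)"
    using assms by (auto simp: mat_trace_def scalar_prod_def atLeast0LessThan intro!: sum.cong)
  finally show ?thesis .
qed

text \<open>A Schur form is triangular with the roots of the characteristic polynomial on the
  diagonal, and the trace is invariant under similarity. Roots are listed with algebraic
  multiplicity, hence the length \<open>d\<close>.\<close>

lemma mat_trace_eigenvalues:
  assumes A: "A \<in> carrier_mat d d"
  obtains es where "length es = d" "mat_trace A = sum_list es"
    "\<And>e. e \<in> set es \<longleftrightarrow> (\<exists>v\<in>carrier_vec d. v \<noteq> 0\<^sub>v d \<and> A *\<^sub>v v = e \<cdot>\<^sub>v v)"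
proof -
  obtain es where es: "char_poly A = (\<Prod>a\<leftarrow>es. [:- a, 1:])" "length es = d"
    using char_poly_factorized[OF A] by blast
  obtain B P Q where B: "schur_decomposition A es = (B, P, Q)"
    by (cases "schur_decomposition A es") auto
  from schur_decomposition[OF A es(1) B]
  have wit: "similar_mat_wit A B P Q" and diag: "diag_mat B = es" by auto
  from similar_mat_witD2[OF A wit]
  have Q: "Q * P = 1\<^sub>m d" "A = P * B * Q" "B \<in> carrier_mat d d" "P \<in> carrier_mat d d"
    "Q \<in> carrier_mat d d" by auto
  have "mat_trace A = mat_trace (Q * (P * B))"
    unfolding Q(2) by (rule mat_trace_mult_comm) (use Q in auto)
  also have "Q * (P * B) = B" using Q by (simp flip: assoc_mult_mat[of Q d d P d B d])
  also have "mat_trace B = sum_list es"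
    unfolding diag[symmetric] diag_mat_def mat_trace_def
    by (simp add: interv_sum_list_conv_sum_set_nat atLeast0LessThan)
  finally have "mat_trace A = sum_list es" .
  moreover have "e \<in> set es \<longleftrightarrow> (\<exists>v\<in>carrier_vec d. v \<noteq> 0\<^sub>v d \<and> A *\<^sub>v v = e \<cdot>\<^sub>v v)" for e
  proof -
    have "poly (\<Prod>a\<leftarrow>es. [:- a, 1:]) e = 0 \<longleftrightarrow> e \<in> set es"
      by (induction es) auto
    then have "e \<in> set es \<longleftrightarrow> eigenvalue A e"
      unfolding es(1)[symmetric] using eigenvalue_root_char_poly[OF A] by simp
    then show ?thesis using A by (auto simp: eigenvalue_def eigenvector_def)
  qed
  ultimately show thesis using that es by blast
qed

text \<open>No diagonalizability is assumed. This matters for the part of a class sum inside a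
  subgroup, of which only the eigenvectors are controlled.\<close>

lemma mat_trace_single_eigenvalue:
  assumes A: "A \<in> carrier_mat d d"
    and ev: "\<And>e v. v \<in> carrier_vec d \<Longrightarrow> v \<noteq> 0\<^sub>v d \<Longrightarrow> A *\<^sub>v v = e \<cdot>\<^sub>v v \<Longrightarrow> e = c"
  shows "mat_trace A = of_nat d * c"
proof -
  obtain es where es: "length es = d" "mat_trace A = sum_list es"
    "\<And>e. e \<in> set es \<longleftrightarrow> (\<exists>v\<in>carrier_vec d. v \<noteq> 0\<^sub>v d \<and> A *\<^sub>v v = e \<cdot>\<^sub>v v)"
    using mat_trace_eigenvalues[OF A] by blast
  have "\<forall>e\<in>set es. e = c" using es(3) ev by blast
  then have "es = replicate d c" using es(1) by (simp add: replicate_eqI)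
  then show ?thesis using es(2) by (simp add: sum_list_replicate)
qed

lemma smult_vec_cancel:
  assumes "a \<cdot>\<^sub>v v = b \<cdot>\<^sub>v v" "v \<in> carrier_vec d" "v \<noteq> 0\<^sub>v d"
  shows "a = (b :: complex)"
proof -
  obtain i where i: "i < d" "v $ i \<noteq> 0"
    using assms(2,3) by (metis carrier_vecD eq_vecI index_zero_vec)
  with arg_cong[OF assms(1), of "\<lambda>v. v $ i"] assms(2) show ?thesis by simp
qed

lemma lin_subspace_eigenspace:
  assumes A: "A \<in> carrier_mat d d"
  shows "lin_subspace d {v \<in> carrier_vec d. A *\<^sub>v v = c \<cdot>\<^sub>v v}"
proof -
  have "A *\<^sub>v 0\<^sub>v d = 0\<^sub>v d" using mult_mat_vec[OF A, of "0\<^sub>v d" 0] A by auto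
  then show ?thesis
    using A by (auto simp: lin_subspace_def mult_add_distrib_mat_vec[OF A] mult_mat_vec[OF A]
        smult_add_distrib_vec smult_smult_assoc mult.commute)
qed

definition msum :: "nat \<Rightarrow> 'i set \<Rightarrow> ('i \<Rightarrow> complex mat) \<Rightarrow> complex mat" where
  "msum d S f = mat d d (\<lambda>(i, j). \<Sum>x\<in>S. f x $$ (i, j))"

lemma msum_carrier [simp]: "msum d S f \<in> carrier_mat d d"
  by (simp add: msum_def)

lemma msum_mult_vec:
  assumes f: "\<And>x. x \<in> S \<Longrightarrow> f x \<in> carrier_mat d d" and v: "v \<in> carrier_vec d"
  shows "msum d S f *\<^sub>v v = vsum d S (\<lambda>x. f x *\<^sub>v v)"
proof (rule eq_vecI)
  fix r assume "r < dim_vec (vsum d S (\<lambda>x. f x *\<^sub>v v))"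
  then have r: "r < d" by simp
  have entry: "msum d S f $$ (r, j) = (\<Sum>x\<in>S. f x $$ (r, j))" if "j < d" for j
    using r that by (simp add: msum_def)
  have "(msum d S f *\<^sub>v v) $ r = (\<Sum>j<d. \<Sum>x\<in>S. f x $$ (r, j) * v $ j)"
    by (simp add: mult_mat_vec_index_sum[OF msum_carrier v r] entry sum_distrib_right
        del: index_mult_mat_vec)
  also have "\<dots> = (\<Sum>x\<in>S. (f x *\<^sub>v v) $ r)"
    by (subst sum.swap) (simp add: mult_mat_vec_index_sum[OF f v r] del: index_mult_mat_vec)
  finally show "(msum d S f *\<^sub>v v) $ r = vsum d S (\<lambda>x. f x *\<^sub>v v) $ r"
    using r by (simp del: index_mult_mat_vec)
qed (simp add: msum_def)

lemma mat_trace_msum: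
  assumes f: "\<And>x. x \<in> S \<Longrightarrow> f x \<in> carrier_mat d d"
  shows "mat_trace (msum d S f) = (\<Sum>x\<in>S. mat_trace (f x))"
proof -
  have "mat_trace (msum d S f) = (\<Sum>i<d. \<Sum>x\<in>S. f x $$ (i, i))"
    by (simp add: mat_trace_def msum_def)
  also have "\<dots> = (\<Sum>x\<in>S. mat_trace (f x))"
    using carrier_matD(1)[OF f] by (subst sum.swap) (simp add: mat_trace_def)
  finally show ?thesis .
qed

lemma mat_eq_of_mult_vec:
  assumes A: "A \<in> carrier_mat n m" and B: "B \<in> carrier_mat n m"
    and eq: "\<And>v. v \<in> carrier_vec m \<Longrightarrow> A *\<^sub>v v = B *\<^sub>v v"
  shows "A = (B :: complex mat)"
proof (rule eq_matI)
  fix i j assume ij: "i < dim_row B" "j < dim_col B"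
  have "(A *\<^sub>v unit_vec m j) $ i = A $$ (i, j)" "(B *\<^sub>v unit_vec m j) $ i = B $$ (i, j)"
    using ij A B by auto
  then show "A $$ (i, j) = B $$ (i, j)" using eq[of "unit_vec m j"] by simp
qed (use A B in auto)

section \<open>Matrix representations\<close>

locale matrix_rep = group G for G (structure) +
  fixes d :: nat and \<rho> :: "'a \<Rightarrow> complex mat"
  assumes rho_carrier [simp]: "g \<in> carrier G \<Longrightarrow> \<rho> g \<in> carrier_mat d d"
    and rho_mult: "g \<in> carrier G \<Longrightarrow> h \<in> carrier G \<Longrightarrow> \<rho> (g \<otimes> h) = \<rho> g * \<rho> h"
    and rho_one [simp]: "\<rho> \<one> = 1\<^sub>m d"
begin

lemma rho_vec_carrier [simp]: "g \<in> carrier G \<Longrightarrow> v \<in> carrier_vec d \<Longrightarrow> \<rho> g *\<^sub>v v \<in> carrier_vec d"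
  by (rule mult_mat_vec_carrier[OF rho_carrier])

lemma rho_zero_vec [simp]: "g \<in> carrier G \<Longrightarrow> \<rho> g *\<^sub>v 0\<^sub>v d = 0\<^sub>v d"
  by (intro eq_vecI) (simp_all add: carrier_matD[OF rho_carrier])

lemma rho_mult_vec:
  assumes "g \<in> carrier G" "h \<in> carrier G" "v \<in> carrier_vec d"
  shows "\<rho> g *\<^sub>v (\<rho> h *\<^sub>v v) = \<rho> (g \<otimes> h) *\<^sub>v v"
  using assms by (simp add: rho_mult assoc_mult_mat_vec[of _ d d _ d])

definition stable :: "complex vec set \<Rightarrow> bool" where
  "stable W \<longleftrightarrow> (\<forall>g\<in>carrier G. \<forall>w\<in>W. \<rho> g *\<^sub>v w \<in> W)"

lemma stableD: "stable W \<Longrightarrow> g \<in> carrier G \<Longrightarrow> w \<in> W \<Longrightarrow> \<rho> g *\<^sub>v w \<in> W"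
  by (simp add: stable_def)

lemma invariant_subspace_iff: "invariant_subspace G d \<rho> W \<longleftrightarrow> lin_subspace d W \<and> stable W"
  by (simp add: invariant_subspace_def subspace_iff_lin_subspace stable_def)

text \<open>\<open>\<rho> (inv g)\<close> inverts \<open>\<rho> g\<close>, which puts the image into
  \<open>GL d\<close>.\<close>

lemma representation: "representation G d \<rho>"
proof -
  have "\<rho> g \<in> Units (ring_mat TYPE(complex) d ())" if "g \<in> carrier G" for g
    using that rho_mult[of g "inv g"] rho_mult[of "inv g" g]
    by (auto simp: Units_def ring_mat_simps intro!: bexI[of _ "\<rho> (inv g)"])
  then show ?thesis
    by (auto simp: representation_def hom_def GL_def units_of_def ring_mat_simps rho_mult)
qed

lemma subgroup_rep: "subgroup H G \<Longrightarrow> matrix_rep (G\<lparr>carrier := H\<rparr>) d \<rho>"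
  using subgroup.subgroup_is_group[of H G] group_axioms subgroup.subset[of H G]
  by (auto simp: matrix_rep_def matrix_rep_axioms_def rho_mult subset_iff)

end

text \<open>Membership in \<open>hom\<close> does not mention the identity; it is preserved because
  the units of the matrix ring form a group.\<close>

lemma representation_imp_matrix_rep:
  assumes "group G" "representation G d \<rho>"
  shows "matrix_rep G d \<rho>"
proof -
  let ?R = "ring_mat TYPE(complex) d ()"
  interpret R: ring ?R by (rule ring_mat)
  have \<rho>: "\<rho> \<in> hom G (units_of ?R)" using assms by (simp add: representation_def GL_def)
  have "\<rho> \<one>\<^bsub>G\<^esub> = \<one>\<^bsub>units_of ?R\<^esub>"
    by (rule hom_one[OF \<rho> assms(1) R.units_group])
  then show ?thesis using \<rho> assms(1)
    by (auto simp: matrix_rep_def matrix_rep_axioms_def hom_def units_of_def Units_def ring_mat_simps)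
qed

locale irr_rep = matrix_rep +
  assumes dim_pos: "0 < d"
    and irr: "lin_subspace d W \<Longrightarrow> stable W \<Longrightarrow> W = {0\<^sub>v d} \<or> W = carrier_vec d"

lemma irreducible_representation_iff:
  assumes "group G"
  shows "irreducible_representation G d \<rho> \<longleftrightarrow> irr_rep G d \<rho>"
proof
  assume *: "irreducible_representation G d \<rho>"
  then interpret matrix_rep G d \<rho>
    using assms representation_imp_matrix_rep by (auto simp: irreducible_representation_def)
  show "irr_rep G d \<rho>"
    using * by unfold_locales (auto simp: irreducible_representation_def invariant_subspace_iff)
next
  assume "irr_rep G d \<rho>"
  then interpret irr_rep G d \<rho> .
  show "irreducible_representation G d \<rho>"
    using representation dim_pos irr
    by (auto simp: irreducible_representation_def invariant_subspace_iff)
qed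

text \<open>Among the nonzero stable subspaces of \<open>W\<close> one of least dimension is chosen,
  and \<open>\<sigma> g\<close> is the restriction of \<open>\<rho> g\<close> in a basis of it. A
  proper nonzero stable subspace for \<open>\<sigma>\<close> would be carried by \<open>B\<close> to
  a smaller one for \<open>\<rho>\<close>.\<close>

lemma (in matrix_rep) irreducible_subrep:
  assumes W: "lin_subspace d W" "stable W" "W \<noteq> {0\<^sub>v d}"
  obtains k B \<sigma> where "B \<in> carrier_mat d k" "injective_mat B" "0 < k" "mat_range B \<subseteq> W"
    "irr_rep G k \<sigma>" "\<And>g. g \<in> carrier G \<Longrightarrow> \<rho> g * B = B * \<sigma> g"
proof -
  define P where "P k B \<longleftrightarrow> 0 < k \<and> B \<in> carrier_mat d k \<and> injective_mat B \<and>
    mat_range B \<subseteq> W \<and> stable (mat_range B)" for k B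
  define k where "k = (LEAST k. \<exists>B. P k B)"
  obtain B0 k0 where "B0 \<in> carrier_mat d k0" "injective_mat B0" "0 < k0" "mat_range B0 = W"
    using subspace_basis_mat[OF W(1,3)] .
  then have "\<exists>B. P k0 B" using W(2) by (auto simp: P_def)
  then have "\<exists>B. P k B" unfolding k_def by (rule LeastI)
  then obtain B where k: "0 < k" and B: "B \<in> carrier_mat d k" "injective_mat B"
    "mat_range B \<subseteq> W" "stable (mat_range B)" by (auto simp: P_def)
  have "\<exists>M. g \<in> carrier G \<longrightarrow> M \<in> carrier_mat k k \<and> \<rho> g * B = B * M" for g
    using mat_restrict[OF rho_carrier B(1,2)] stableD[OF B(4)] by metis
  then obtain \<sigma> where \<sigma>: "\<And>g. g \<in> carrier G \<Longrightarrow> \<sigma> g \<in> carrier_mat k k"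
    "\<And>g. g \<in> carrier G \<Longrightarrow> \<rho> g * B = B * \<sigma> g" by metis
  have cancel: "M = N" if "M \<in> carrier_mat k k" "N \<in> carrier_mat k k" "B * M = B * N" for M N
  proof (rule mat_col_eqI)
    fix j assume "j < dim_col N"
    then have j: "j < k" using that by simp
    have "B *\<^sub>v col M j = col (B * M) j" "B *\<^sub>v col N j = col (B * N) j"
      by (simp_all add: col_mult2[OF B(1) that(1) j] col_mult2[OF B(1) that(2) j])
    with that(3) have "B *\<^sub>v col M j = B *\<^sub>v col N j" by simp
    then show "col M j = col N j"
      using injective_mat_eqD[OF B(2,1)] that j by auto
  qed (use that in auto)
  have \<sigma>_mult: "\<sigma> (g \<otimes> h) = \<sigma> g * \<sigma> h" if gh: "g \<in> carrier G" "h \<in> carrier G" for g h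
  proof (rule cancel)
    have "B * \<sigma> (g \<otimes> h) = \<rho> g * (\<rho> h * B)"
      using gh B \<sigma>(2)[of "g \<otimes> h"] assoc_mult_mat[of "\<rho> g" d d "\<rho> h" d B k]
      by (simp add: rho_mult)
    also have "\<dots> = (\<rho> g * B) * \<sigma> h"
      using gh B \<sigma> assoc_mult_mat[of "\<rho> g" d d B k "\<sigma> h" k] by simp
    also have "\<dots> = B * (\<sigma> g * \<sigma> h)"
      using gh B \<sigma> assoc_mult_mat[of B d k "\<sigma> g" k "\<sigma> h" k] by simp
    finally show "B * \<sigma> (g \<otimes> h) = B * (\<sigma> g * \<sigma> h)" .
  qed (use gh \<sigma>(1) mult_carrier_mat[OF \<sigma>(1)[OF gh(1)] \<sigma>(1)[OF gh(2)]] in simp_all)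
  have \<sigma>_one: "\<sigma> \<one> = 1\<^sub>m k"
  proof (rule cancel)
    have "B * \<sigma> \<one> = 1\<^sub>m d * B" using \<sigma>(2)[OF one_closed] by simp
    then show "B * \<sigma> \<one> = B * 1\<^sub>m k"
      by (simp only: left_mult_one_mat[OF B(1)] right_mult_one_mat[OF B(1)])
  qed (use \<sigma>(1) in auto)
  interpret S: matrix_rep G k \<sigma>
    using \<sigma>(1) \<sigma>_mult \<sigma>_one by unfold_locales auto
  have B\<sigma>: "B *\<^sub>v (\<sigma> g *\<^sub>v x) = \<rho> g *\<^sub>v (B *\<^sub>v x)" if "g \<in> carrier G" "x \<in> carrier_vec k" for g x
    using that B \<sigma> assoc_mult_mat_vec[of "\<rho> g" d d B k x] assoc_mult_mat_vec[of B d k "\<sigma> g" k x]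
    by simp
  have "irr_rep G k \<sigma>"
  proof unfold_locales
    fix U assume U: "lin_subspace k U" "S.stable U"
    show "U = {0\<^sub>v k} \<or> U = carrier_vec k"
    proof (rule disjCI)
      assume "U \<noteq> carrier_vec k"
      show "U = {0\<^sub>v k}"
      proof (rule ccontr)
        assume "U \<noteq> {0\<^sub>v k}"
        then obtain C l where C: "C \<in> carrier_mat k l" "injective_mat C" "0 < l" "mat_range C = U"
          using subspace_basis_mat[OF U(1)] by blast
        have BC: "w \<in> mat_range (B * C) \<longleftrightarrow> (\<exists>u\<in>U. w = B *\<^sub>v u)" for w
        proof -
          have "w \<in> mat_range (B * C) \<longleftrightarrow> (\<exists>x\<in>carrier_vec l. w = B *\<^sub>v (C *\<^sub>v x))"
            using B C mat_range_iff[of "B * C" d l w] by auto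
          also have "\<dots> \<longleftrightarrow> (\<exists>u\<in>U. w = B *\<^sub>v u)"
            unfolding C(4)[symmetric] using mat_range_iff[OF C(1)] by auto
          finally show ?thesis .
        qed
        have Uk: "U \<subseteq> carrier_vec k" using U by (auto simp: lin_subspace_def)
        have "P l (B * C)"
          unfolding P_def
        proof (intro conjI)
          show "injective_mat (B * C)" by (rule injective_mat_mult[OF B(2,1) C(2,1)])
          have "B *\<^sub>v u \<in> mat_range B" if "u \<in> U" for u
            using that Uk by (auto simp: mat_range_iff[OF B(1)])
          with B(3) have "B *\<^sub>v u \<in> W" if "u \<in> U" for u using that by blast
          then show "mat_range (B * C) \<subseteq> W" using BC by auto
          have "\<rho> g *\<^sub>v (B *\<^sub>v u) \<in> mat_range (B * C)" if "g \<in> carrier G" "u \<in> U" for g u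
            unfolding BC using that Uk B\<sigma>[of g u] S.stableD[OF U(2) that]
            by (intro bexI[of _ "\<sigma> g *\<^sub>v u"]) auto
          then show "stable (mat_range (B * C))" unfolding stable_def using BC by auto
        qed (use B C in auto)
        then have "k \<le> l" unfolding k_def by (intro Least_le) blast
        with injective_mat_dim_le[OF C(2,1)] have "l = k" by simp
        then have "carrier_vec k \<subseteq> U" using injective_square_mat_surj[OF C(2)] C(1,4) by auto
        with Uk \<open>U \<noteq> carrier_vec k\<close> show False by auto
      qed
    qed
  qed (rule k)
  then show thesis by (rule that[OF B(1,2) k B(3) _ \<sigma>(2)])
qed

text \<open>The chosen representative depends only on the left coset as a set, so the
  representatives meet each coset exactly once; within a coset, cancellation makes the factor from
  \<open>H\<close> unique.\<close>

lemma (in group) transversal_exists: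
  assumes fin: "finite (carrier G)" and H: "subgroup H G"
  obtains T where "T \<subseteq> carrier G" "finite T" "card T * card H = card (carrier G)"
    "bij_betw (\<lambda>(t, h). t \<otimes> h) (T \<times> H) (carrier G)"
proof -
  have HG: "H \<subseteq> carrier G" by (rule subgroup.subset[OF H])
  define C where "C g = (\<lambda>h. g \<otimes> h) ` H" for g
  define rep where "rep g = (SOME x. x \<in> C g)" for g
  have rep: "\<exists>h\<in>H. rep g = g \<otimes> h" if "g \<in> carrier G" for g
  proof -
    have "g \<in> C g" unfolding C_def using subgroup.one_closed[OF H] that by (force intro: image_eqI[of _ _ \<one>])
    then have "rep g \<in> C g" unfolding rep_def by (rule someI)
    then show ?thesis by (auto simp: C_def)
  qed
  have rep_mult: "rep (g \<otimes> h) = rep g" if g: "g \<in> carrier G" and h: "h \<in> H" for g h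
  proof -
    have "C (g \<otimes> h) = C g"
    proof (intro equalityI subsetI)
      fix x assume "x \<in> C (g \<otimes> h)"
      then obtain h' where "h' \<in> H" "x = g \<otimes> h \<otimes> h'" by (auto simp: C_def)
      then show "x \<in> C g" unfolding C_def using g h HG subgroup.m_closed[OF H]
        by (intro image_eqI[of _ _ "h \<otimes> h'"]) (auto simp: m_assoc subset_iff)
    next
      fix x assume "x \<in> C g"
      then obtain h' where h': "h' \<in> H" "x = g \<otimes> h'" by (auto simp: C_def)
      have "g \<otimes> h' = g \<otimes> h \<otimes> (inv h \<otimes> h')"
        using g h h' HG by (simp add: subset_iff m_assoc[symmetric] inv_solve_right)
      then show "x \<in> C (g \<otimes> h)" unfolding C_def using g h h' HG
          subgroup.m_closed[OF H] subgroup.m_inv_closed[OF H]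
        by (intro image_eqI[of _ _ "inv h \<otimes> h'"]) auto
    qed
    then show ?thesis by (simp add: rep_def)
  qed
  define T where "T = rep ` carrier G"
  have repG: "rep g \<in> carrier G" if "g \<in> carrier G" for g
    using rep[OF that] that HG by auto
  have TG: "T \<subseteq> carrier G" using repG by (auto simp: T_def)
  have repT: "rep t = t" if "t \<in> T" for t
    using that rep rep_mult by (auto simp: T_def) metis
  have bij: "bij_betw (\<lambda>(t, h). t \<otimes> h) (T \<times> H) (carrier G)"
    unfolding bij_betw_def
  proof
    show "inj_on (\<lambda>(t, h). t \<otimes> h) (T \<times> H)"
    proof (rule inj_onI, clarify)
      fix t h t' h' assume *: "t \<in> T" "h \<in> H" "t' \<in> T" "h' \<in> H" "t \<otimes> h = t' \<otimes> h'"
      then have "t = t'" using rep_mult[of t h] rep_mult[of t' h'] repT TG by (metis subsetD)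
      with * show "t = t' \<and> h = h'" using TG HG by (metis Units_eq Units_l_cancel subsetD)
    qed
    show "(\<lambda>(t, h). t \<otimes> h) ` (T \<times> H) = carrier G"
    proof (intro equalityI subsetI)
      fix g assume g: "g \<in> carrier G"
      from rep[OF g] obtain h where h: "h \<in> H" "rep g = g \<otimes> h" by auto
      then have eq: "g = rep g \<otimes> inv h" using g HG by (simp add: inv_solve_right subset_iff)
      have "(rep g, inv h) \<in> T \<times> H"
        using g h(1) subgroup.m_inv_closed[OF H] by (simp add: T_def)
      then show "g \<in> (\<lambda>(t, h). t \<otimes> h) ` (T \<times> H)"
        by (rule image_eqI[rotated]) (subst prod.case, rule eq)
    qed (use TG HG in auto)
  qed
  have "card T * card H = card (carrier G)"
    using bij_betw_same_card[OF bij] by (simp add: card_cartesian_product)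
  moreover have "finite T" using fin by (simp add: T_def)
  ultimately show thesis using that TG bij by blast
qed

text \<open>The second part says that the sum of the translates of \<open>mat_range B\<close> is direct if their number
  is just large enough for them to span the whole space.\<close>

lemma (in irr_rep) dim_le_index_mult:
  assumes fin: "finite (carrier G)" and H: "subgroup H G"
    and B: "B \<in> carrier_mat d k" "injective_mat B" "0 < k"
    and stab: "\<forall>h\<in>H. \<forall>w\<in>mat_range B. \<rho> h *\<^sub>v w \<in> mat_range B"
  shows "d * card H \<le> card (carrier G) * k" (is ?le)
    and "d * card H = card (carrier G) * k \<Longrightarrow>
      \<forall>g\<in>carrier G. w g \<in> mat_range B \<Longrightarrow>
      vsum d (carrier G) (\<lambda>g. \<rho> g *\<^sub>v w g) = 0\<^sub>v d \<Longrightarrow> vsum d H (\<lambda>h. \<rho> h *\<^sub>v w h) = 0\<^sub>v d"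
proof -
  note W = lin_subspace_mat_range[OF B(1)]
  have HG: "H \<subseteq> carrier G" by (rule subgroup.subset[OF H])
  have finH: "finite H" using HG fin by (rule finite_subset)
  obtain T where T: "T \<subseteq> carrier G" "finite T" "card T * card H = card (carrier G)"
    "bij_betw (\<lambda>(t, h). t \<otimes> h) (T \<times> H) (carrier G)"
    using transversal_exists[OF fin H] .
  have cardH: "0 < card H" using finH subgroup.one_closed[OF H] by (auto simp: card_gt_0_iff)
  \<comment> \<open>One copy of the basis \<open>B\<close> for every coset representative: index
    times \<open>k\<close> vectors, which turn out to span.\<close>
  define I where "I = T \<times> {..<k}"
  define a where "a = (\<lambda>(t, j). \<rho> t *\<^sub>v col B j)"
  have finI: "finite I" and cardI: "card I = card T * k" using T by (auto simp: I_def)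
  have a: "a i \<in> carrier_vec d" if "i \<in> I" for i
  proof -
    obtain t j where i: "i = (t, j)" "t \<in> carrier G"
      using \<open>i \<in> I\<close> T(1) by (auto simp: I_def)
    show ?thesis
      using i mult_mat_vec_carrier[OF rho_carrier[OF i(2)], of "col B j"] B(1)
      by (simp add: a_def carrier_vecI)
  qed
  have Bcols: "B *\<^sub>v x = vsum d {..<k} (\<lambda>j. x $ j \<cdot>\<^sub>v col B j)" if "x \<in> carrier_vec k" for x
    using that B(1) by (intro eq_vecI) (auto simp: scalar_prod_def atLeast0LessThan mult.commute)
  \<comment> \<open>All terms with \<open>g\<close> in one coset of \<open>H\<close> collapse to
    \<open>\<rho> t\<close> applied to a single vector of \<open>mat_range B\<close>, since
    \<open>H\<close> stabilises that range.\<close>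
  have block: "\<exists>x. vsum d H (\<lambda>h. \<rho> (t \<otimes> h) *\<^sub>v w (t \<otimes> h)) = vsum d {..<k} (\<lambda>j. x j \<cdot>\<^sub>v a (t, j))"
    if w: "\<And>g. g \<in> carrier G \<Longrightarrow> w g \<in> mat_range B" and t: "t \<in> carrier G" for w t
  proof -
    have wd: "w g \<in> carrier_vec d" if "g \<in> carrier G" for g
      using w[OF that] W by (auto simp: lin_subspace_def)
    have "vsum d H (\<lambda>h. \<rho> h *\<^sub>v w (t \<otimes> h)) \<in> mat_range B"
      using W w t HG stab by (intro lin_subspace_vsum) (auto simp: subset_iff)
    then obtain x where x: "x \<in> carrier_vec k" "vsum d H (\<lambda>h. \<rho> h *\<^sub>v w (t \<otimes> h)) = B *\<^sub>v x"
      using mat_range_iff[OF B(1)] by auto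
    have "vsum d H (\<lambda>h. \<rho> (t \<otimes> h) *\<^sub>v w (t \<otimes> h)) = vsum d H (\<lambda>h. \<rho> t *\<^sub>v (\<rho> h *\<^sub>v w (t \<otimes> h)))"
      using t HG wd by (intro vsum_cong) (auto simp: rho_mult_vec subset_iff)
    also have "\<dots> = \<rho> t *\<^sub>v (B *\<^sub>v x)"
      unfolding x(2)[symmetric] using t subsetD[OF HG] wd
      by (intro mult_mat_vec_vsum[OF rho_carrier, symmetric]) simp_all
    also have "\<dots> = vsum d {..<k} (\<lambda>j. \<rho> t *\<^sub>v (x $ j \<cdot>\<^sub>v col B j))"
      unfolding Bcols[OF x(1)] using t B(1) by (intro mult_mat_vec_vsum) auto
    also have "\<dots> = vsum d {..<k} (\<lambda>j. x $ j \<cdot>\<^sub>v a (t, j))"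
      using t B(1) by (intro vsum_cong) (auto simp: a_def mult_mat_vec[of _ d d])
    finally show ?thesis by blast
  qed
  have split: "vsum d (carrier G) f = vsum d T (\<lambda>t. vsum d H (\<lambda>h. f (t \<otimes> h)))" for f
  proof -
    have "vsum d (carrier G) f = vsum d (T \<times> H) (\<lambda>i. f (case i of (t, h) \<Rightarrow> t \<otimes> h))"
      using T(4) vsum_reindex[of "\<lambda>(t, h). t \<otimes> h" "T \<times> H" d f] by (simp add: bij_betw_def)
    then show ?thesis by (simp add: vsum_Sigma[OF T(2) finH])
  qed
  have comb: "\<exists>x. (\<forall>t\<in>T. vsum d H (\<lambda>h. \<rho> (t \<otimes> h) *\<^sub>v w (t \<otimes> h)) = vsum d {..<k} (\<lambda>j. x (t, j) \<cdot>\<^sub>v a (t, j))) \<and>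
      vsum d (carrier G) (\<lambda>g. \<rho> g *\<^sub>v w g) = vsum d I (\<lambda>i. x i \<cdot>\<^sub>v a i)"
    if w: "\<forall>g\<in>carrier G. w g \<in> mat_range B" for w
  proof -
    have "\<forall>t. \<exists>x. t \<in> T \<longrightarrow> vsum d H (\<lambda>h. \<rho> (t \<otimes> h) *\<^sub>v w (t \<otimes> h)) = vsum d {..<k} (\<lambda>j. x j \<cdot>\<^sub>v a (t, j))"
      using block[of w] w T(1) by (metis subsetD)
    then obtain x where x: "\<And>t. t \<in> T \<Longrightarrow> vsum d H (\<lambda>h. \<rho> (t \<otimes> h) *\<^sub>v w (t \<otimes> h)) =
        vsum d {..<k} (\<lambda>j. x t j \<cdot>\<^sub>v a (t, j))" by metis
    then have "vsum d (carrier G) (\<lambda>g. \<rho> g *\<^sub>v w g) = vsum d I (\<lambda>i. case_prod x i \<cdot>\<^sub>v a i)"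
      unfolding split I_def using T(2) by (subst vsum_Sigma) (auto intro!: vsum_cong)
    then show ?thesis using x by (intro exI[of _ "case_prod x"]) auto
  qed
  \<comment> \<open>The sum of all translates of \<open>mat_range B\<close>. Indexing by the whole
    group rather than by representatives turns stability into a reindexing by left
    multiplication.\<close>
  define U where "U = {vsum d (carrier G) (\<lambda>g. \<rho> g *\<^sub>v w g) |w. \<forall>g\<in>carrier G. w g \<in> mat_range B}"
  have wd: "w g \<in> carrier_vec d" if "\<forall>g\<in>carrier G. w g \<in> mat_range B" "g \<in> carrier G" for w g
    using that W by (auto simp: lin_subspace_def)
  have U: "lin_subspace d U"
    unfolding lin_subspace_def
  proof (intro conjI ballI allI)
    show "U \<subseteq> carrier_vec d" by (auto simp: U_def)
    have "vsum d (carrier G) (\<lambda>g. \<rho> g *\<^sub>v 0\<^sub>v d) = 0\<^sub>v d"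
      by (rule eq_vecI) (auto intro!: sum.neutral)
    then show "0\<^sub>v d \<in> U" unfolding U_def using W
      by (auto simp: lin_subspace_def intro!: exI[of _ "\<lambda>_. 0\<^sub>v d"])
  next
    fix u v assume "u \<in> U" "v \<in> U"
    then obtain w z where u: "u = vsum d (carrier G) (\<lambda>g. \<rho> g *\<^sub>v w g)" "\<forall>g\<in>carrier G. w g \<in> mat_range B"
      and v: "v = vsum d (carrier G) (\<lambda>g. \<rho> g *\<^sub>v z g)" "\<forall>g\<in>carrier G. z g \<in> mat_range B"
      by (auto simp: U_def)
    have "u + v = vsum d (carrier G) (\<lambda>g. \<rho> g *\<^sub>v (w g + z g))"
    proof (rule eq_vecI)
      fix r assume "r < dim_vec (vsum d (carrier G) (\<lambda>g. \<rho> g *\<^sub>v (w g + z g)))"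
      then have r: "r < d" by simp
      have "(\<rho> g *\<^sub>v (w g + z g)) $ r = (\<rho> g *\<^sub>v w g) $ r + (\<rho> g *\<^sub>v z g) $ r"
        if "g \<in> carrier G" for g
        using r wd[OF u(2) that] wd[OF v(2) that] rho_carrier[OF that]
        by (simp add: mult_add_distrib_mat_vec[of _ d d] del: index_mult_mat_vec)
      then show "(u + v) $ r = vsum d (carrier G) (\<lambda>g. \<rho> g *\<^sub>v (w g + z g)) $ r"
        unfolding u v using r by (simp add: sum.distrib del: index_mult_mat_vec)
    qed (simp add: u v)
    then show "u + v \<in> U" unfolding U_def using W u(2) v(2)
      by (auto simp: lin_subspace_def intro!: exI[of _ "\<lambda>g. w g + z g"])
  next
    fix c v assume "v \<in> U"
    then obtain w where v: "v = vsum d (carrier G) (\<lambda>g. \<rho> g *\<^sub>v w g)" "\<forall>g\<in>carrier G. w g \<in> mat_range B"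
      by (auto simp: U_def)
    have "c \<cdot>\<^sub>v v = vsum d (carrier G) (\<lambda>g. \<rho> g *\<^sub>v (c \<cdot>\<^sub>v w g))"
    proof (rule eq_vecI)
      fix r assume "r < dim_vec (vsum d (carrier G) (\<lambda>g. \<rho> g *\<^sub>v (c \<cdot>\<^sub>v w g)))"
      then have r: "r < d" by simp
      have "(\<rho> g *\<^sub>v (c \<cdot>\<^sub>v w g)) $ r = c * (\<rho> g *\<^sub>v w g) $ r" if "g \<in> carrier G" for g
        using r wd[OF v(2) that] rho_carrier[OF that]
        by (simp add: mult_mat_vec[of _ d d] del: index_mult_mat_vec)
      then show "(c \<cdot>\<^sub>v v) $ r = vsum d (carrier G) (\<lambda>g. \<rho> g *\<^sub>v (c \<cdot>\<^sub>v w g)) $ r"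
        unfolding v using r by (simp add: sum_distrib_left del: index_mult_mat_vec)
    qed (simp add: v)
    then show "c \<cdot>\<^sub>v v \<in> U" unfolding U_def using W v(2)
      by (auto simp: lin_subspace_def intro!: exI[of _ "\<lambda>g. c \<cdot>\<^sub>v w g"])
  qed
  have stU: "stable U"
    unfolding stable_def
  proof (intro ballI)
    fix x u assume x: "x \<in> carrier G" and "u \<in> U"
    then obtain w where u: "u = vsum d (carrier G) (\<lambda>g. \<rho> g *\<^sub>v w g)" "\<forall>g\<in>carrier G. w g \<in> mat_range B"
      by (auto simp: U_def)
    have bij: "inj_on (\<lambda>g. x \<otimes> g) (carrier G)" "(\<lambda>g. x \<otimes> g) ` carrier G = carrier G"
      using x surj_const_mult inj_on_cmult by auto
    have "\<rho> x *\<^sub>v u = vsum d (carrier G) (\<lambda>g. \<rho> x *\<^sub>v (\<rho> g *\<^sub>v w g))"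
      unfolding u(1) using x wd[OF u(2)] by (intro mult_mat_vec_vsum) auto
    \<comment> \<open>The argument of \<open>w\<close> is rewritten so that the summand depends on
      \<open>x \<otimes> g\<close> alone.\<close>
    also have "\<dots> = vsum d (carrier G) (\<lambda>g. \<rho> (x \<otimes> g) *\<^sub>v w (inv x \<otimes> (x \<otimes> g)))"
      using x wd[OF u(2)] by (intro vsum_cong) (auto simp: rho_mult_vec m_assoc[symmetric])
    also have "\<dots> = vsum d (carrier G) (\<lambda>g. \<rho> g *\<^sub>v w (inv x \<otimes> g))"
      using vsum_reindex[OF bij(1), of d "\<lambda>g. \<rho> g *\<^sub>v w (inv x \<otimes> g)"] bij(2) by simp
    finally show "\<rho> x *\<^sub>v u \<in> U" unfolding U_def using x u(2)
      by (auto intro!: exI[of _ "\<lambda>g. w (inv x \<otimes> g)"])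
  qed
  \<comment> \<open>The witness is the choice function supported at the identity.\<close>
  have BU: "mat_range B \<subseteq> U"
  proof
    fix v assume v: "v \<in> mat_range B"
    have vd: "v \<in> carrier_vec d" using v W by (auto simp: lin_subspace_def)
    have eq: "v = vsum d (carrier G) (\<lambda>g. \<rho> g *\<^sub>v (if g = \<one> then v else 0\<^sub>v d))"
    proof (rule eq_vecI)
      fix r assume "r < dim_vec (vsum d (carrier G) (\<lambda>g. \<rho> g *\<^sub>v (if g = \<one> then v else 0\<^sub>v d)))"
      then have r: "r < d" by simp
      have "(\<Sum>g\<in>carrier G. (\<rho> g *\<^sub>v (if g = \<one> then v else 0\<^sub>v d)) $ r) =
          (\<Sum>g\<in>carrier G. if g = \<one> then v $ r else 0)"
        using r vd by (intro sum.cong) auto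
      then show "v $ r = vsum d (carrier G) (\<lambda>g. \<rho> g *\<^sub>v (if g = \<one> then v else 0\<^sub>v d)) $ r"
        using r fin by simp
    qed (use vd in auto)
    have "\<forall>g\<in>carrier G. (if g = \<one> then v else 0\<^sub>v d) \<in> mat_range B"
      using v W by (simp add: lin_subspace_def)
    with eq show "v \<in> U" unfolding U_def
      by (intro CollectI exI[of _ "\<lambda>g. if g = \<one> then v else 0\<^sub>v d"] conjI)
  qed
  have "B *\<^sub>v unit_vec k 0 \<noteq> 0\<^sub>v d"
    using injective_matD[OF B(2,1), of "unit_vec k 0"] B(3) by auto
  moreover have "B *\<^sub>v unit_vec k 0 \<in> mat_range B"
    unfolding mat_range_iff[OF B(1)] by (rule bexI[of _ "unit_vec k 0"]) simp_all
  then have "B *\<^sub>v unit_vec k 0 \<in> U" using BU by auto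
  ultimately have "U \<noteq> {0\<^sub>v d}" by blast
  then have "U = carrier_vec d" using irr[OF U stU] by blast
  then have span: "\<exists>x. v = vsum d I (\<lambda>i. x i \<cdot>\<^sub>v a i)" if v: "v \<in> carrier_vec d" for v
  proof -
    have "v \<in> U" using v \<open>U = carrier_vec d\<close> by simp
    then obtain w where
      w: "\<forall>g\<in>carrier G. w g \<in> mat_range B" "v = vsum d (carrier G) (\<lambda>g. \<rho> g *\<^sub>v w g)"
      by (auto simp: U_def)
    from comb[OF w(1)] show ?thesis unfolding w(2) by (elim exE conjE) (rule exI)
  qed
  have "d \<le> card T * k" using spanning_family_dim(1)[OF finI a span] by (simp add: cardI)
  then have "d * card H \<le> card T * k * card H" by (rule mult_le_mono1)
  then show ?le unfolding T(3)[symmetric] by (simp only: ac_simps)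
  assume eq: "d * card H = card (carrier G) * k"
    and w: "\<forall>g\<in>carrier G. w g \<in> mat_range B"
    and 0: "vsum d (carrier G) (\<lambda>g. \<rho> g *\<^sub>v w g) = 0\<^sub>v d"
  have "d * card H = card T * k * card H" unfolding eq T(3)[symmetric] by (simp only: ac_simps)
  then have d: "d = card I" using cardH by (simp add: cardI)
  from comb[OF w] obtain x where
    x: "\<forall>t\<in>T. vsum d H (\<lambda>h. \<rho> (t \<otimes> h) *\<^sub>v w (t \<otimes> h)) = vsum d {..<k} (\<lambda>j. x (t, j) \<cdot>\<^sub>v a (t, j))"
    and sum: "vsum d (carrier G) (\<lambda>g. \<rho> g *\<^sub>v w g) = vsum d I (\<lambda>i. x i \<cdot>\<^sub>v a i)"
    by (elim exE conjE)
  \<comment> \<open>With exactly \<open>d\<close> spanning vectors all coefficients vanish, so every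
    coset block of the sum vanishes separately.\<close>
  have x0: "x i = 0" if "i \<in> I" for i
    by (rule spanning_family_dim(2)[where x = x, OF finI a span d _ that]) (simp_all only: sum[symmetric] 0)
  \<comment> \<open>The representative of the coset \<open>H\<close> lies in \<open>H\<close> but
    need not be the identity. Translation by it permutes \<open>H\<close>, so its block is the sum
    over \<open>H\<close>.\<close>
  from T(4) have "\<one> \<in> (\<lambda>(t, h). t \<otimes> h) ` (T \<times> H)" by (auto simp: bij_betw_def)
  then obtain t h where t: "t \<in> T" "h \<in> H" "\<one> = t \<otimes> h" by auto
  then have "t = inv h" using T(1) HG by (metis inv_equality subsetD)
  then have tH: "t \<in> H" using t subgroup.m_inv_closed[OF H] by simp
  have bij: "inj_on (\<lambda>h. t \<otimes> h) H" "(\<lambda>h. t \<otimes> h) ` H = H"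
  proof -
    interpret HH: group "G\<lparr>carrier := H\<rparr>" by (rule subgroup.subgroup_is_group[OF H group_axioms])
    show "inj_on (\<lambda>h. t \<otimes> h) H" "(\<lambda>h. t \<otimes> h) ` H = H"
      using HH.inj_on_cmult[of t] HH.surj_const_mult[of t] tH by auto
  qed
  have "vsum d H (\<lambda>h. \<rho> h *\<^sub>v w h) = vsum d H (\<lambda>h. \<rho> (t \<otimes> h) *\<^sub>v w (t \<otimes> h))"
    using vsum_reindex[OF bij(1), of d "\<lambda>h. \<rho> h *\<^sub>v w h"] bij(2) by simp
  also have "\<dots> = vsum d {..<k} (\<lambda>j. x (t, j) \<cdot>\<^sub>v a (t, j))" by (rule bspec[OF x t(1)])
  also have "\<dots> = 0\<^sub>v d"
  proof (rule eq_vecI)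
    fix r assume "r < dim_vec (0\<^sub>v d :: complex vec)"
    then show "vsum d {..<k} (\<lambda>j. x (t, j) \<cdot>\<^sub>v a (t, j)) $ r = 0\<^sub>v d $ r"
      using x0 t(1) carrier_vecD[OF a] by (auto simp: I_def intro!: sum.neutral)
  qed simp
  finally show "vsum d H (\<lambda>h. \<rho> h *\<^sub>v w h) = 0\<^sub>v d" .
qed

section \<open>Characters and codegrees\<close>

context matrix_rep
begin

lemma mat_trace_conj:
  assumes "g \<in> carrier G" "x \<in> carrier G"
  shows "mat_trace (\<rho> (g \<otimes> x \<otimes> inv g)) = mat_trace (\<rho> x)"
proof -
  have "mat_trace (\<rho> (g \<otimes> x \<otimes> inv g)) = mat_trace (\<rho> (g \<otimes> x) * \<rho> (inv g))"
    using assms by (simp add: rho_mult)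
  also have "\<dots> = mat_trace (\<rho> (inv g) * \<rho> (g \<otimes> x))"
    using assms by (intro mat_trace_mult_comm[of _ d d]) auto
  also have "\<rho> (inv g) * \<rho> (g \<otimes> x) = \<rho> x"
    using assms by (simp flip: rho_mult add: m_assoc[symmetric])
  finally show ?thesis .
qed

text \<open>Rests on \<rho>(g y g^-1) \<rho>(g) = \<rho>(g) \<rho>(y). It serves a conjugacy class
  with \<open>g\<close> in the group, and the part of the class in a subgroup with \<open>g\<close>
  in that subgroup.\<close>

lemma vsum_conj_stable:
  assumes S: "S \<subseteq> carrier G" and g: "g \<in> carrier G" and conj: "(\<lambda>y. g \<otimes> y \<otimes> inv g) ` S = S"
    and v: "v \<in> carrier_vec d"
  shows "vsum d S (\<lambda>y. \<rho> y *\<^sub>v (\<rho> g *\<^sub>v v)) = \<rho> g *\<^sub>v vsum d S (\<lambda>y. \<rho> y *\<^sub>v v)"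
proof -
  have inj: "inj_on (\<lambda>y. g \<otimes> y \<otimes> inv g) S"
    using S g by (intro inj_onI) (auto simp: subset_iff)
  have "vsum d S (\<lambda>y. \<rho> y *\<^sub>v (\<rho> g *\<^sub>v v)) =
      vsum d ((\<lambda>y. g \<otimes> y \<otimes> inv g) ` S) (\<lambda>y. \<rho> y *\<^sub>v (\<rho> g *\<^sub>v v))" by (simp only: conj)
  also have "\<dots> = vsum d S (\<lambda>y. \<rho> (g \<otimes> y \<otimes> inv g) *\<^sub>v (\<rho> g *\<^sub>v v))"
    by (rule vsum_reindex[OF inj])
  also have "\<dots> = vsum d S (\<lambda>y. \<rho> g *\<^sub>v (\<rho> y *\<^sub>v v))"
    using S g v by (intro vsum_cong) (auto simp: rho_mult_vec m_assoc subset_iff)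
  also have "\<dots> = \<rho> g *\<^sub>v vsum d S (\<lambda>y. \<rho> y *\<^sub>v v)"
    using S v g by (intro mult_mat_vec_vsum[OF rho_carrier, symmetric]) (auto simp: subset_iff)
  finally show ?thesis .
qed

lemma vsum_carrier_fixed:
  assumes x: "x \<in> carrier G" and v: "v \<in> carrier_vec d"
  shows "\<rho> x *\<^sub>v vsum d (carrier G) (\<lambda>g. \<rho> g *\<^sub>v v) = vsum d (carrier G) (\<lambda>g. \<rho> g *\<^sub>v v)"
proof -
  have bij: "inj_on (\<lambda>g. x \<otimes> g) (carrier G)" "(\<lambda>g. x \<otimes> g) ` carrier G = carrier G"
    using x surj_const_mult inj_on_cmult by auto
  have "\<rho> x *\<^sub>v vsum d (carrier G) (\<lambda>g. \<rho> g *\<^sub>v v) = vsum d (carrier G) (\<lambda>g. \<rho> x *\<^sub>v (\<rho> g *\<^sub>v v))"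
    using x v by (intro mult_mat_vec_vsum[OF rho_carrier]) auto
  also have "\<dots> = vsum d (carrier G) (\<lambda>g. \<rho> (x \<otimes> g) *\<^sub>v v)"
    using x v by (intro vsum_cong) (auto simp: rho_mult_vec)
  also have "\<dots> = vsum d (carrier G) (\<lambda>g. \<rho> g *\<^sub>v v)"
    using vsum_reindex[OF bij(1), of d "\<lambda>g. \<rho> g *\<^sub>v v"] bij(2) by simp
  finally show ?thesis .
qed

end

section \<open>Schur's lemma, fixed vectors and dimension bounds\<close>

context irr_rep
begin

text \<open>The eigenspace for an eigenvalue of \<open>A\<close> is stable and nonzero, hence the
  whole space.\<close>

lemma schur:
  assumes A: "A \<in> carrier_mat d d"
    and comm: "\<And>g v. g \<in> carrier G \<Longrightarrow> v \<in> carrier_vec d \<Longrightarrow> A *\<^sub>v (\<rho> g *\<^sub>v v) = \<rho> g *\<^sub>v (A *\<^sub>v v)"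
  obtains c where "\<And>v. v \<in> carrier_vec d \<Longrightarrow> A *\<^sub>v v = c \<cdot>\<^sub>v v"
proof -
  obtain c v where v: "v \<in> carrier_vec d" "v \<noteq> 0\<^sub>v d" "A *\<^sub>v v = c \<cdot>\<^sub>v v"
    using eigenvalue_exists[OF A dim_pos] .
  define E where "E = {v \<in> carrier_vec d. A *\<^sub>v v = c \<cdot>\<^sub>v v}"
  have "lin_subspace d E" unfolding E_def by (rule lin_subspace_eigenspace[OF A])
  moreover have "stable E"
    by (auto simp: stable_def E_def comm mult_mat_vec[OF rho_carrier])
  moreover have "E \<noteq> {0\<^sub>v d}" using v by (auto simp: E_def)
  ultimately have "E = carrier_vec d" using irr by auto
  then show thesis using that by (auto simp: E_def)
qed

text \<open>The fixed vectors form a stable subspace. This takes the place of orthogonality to the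
  trivial character.\<close>

lemma fixed_vector_trivial:
  assumes u: "u \<in> carrier_vec d" "u \<noteq> 0\<^sub>v d" and fix_u: "\<And>g. g \<in> carrier G \<Longrightarrow> \<rho> g *\<^sub>v u = u"
    and g: "g \<in> carrier G"
  shows "\<rho> g = 1\<^sub>m d"
proof -
  define E where "E = {v \<in> carrier_vec d. \<forall>g\<in>carrier G. \<rho> g *\<^sub>v v = v}"
  have "lin_subspace d E"
    by (auto simp: lin_subspace_def E_def mult_add_distrib_mat_vec[OF rho_carrier] mult_mat_vec[OF rho_carrier])
  moreover have "stable E" by (auto simp: stable_def E_def)
  moreover have "E \<noteq> {0\<^sub>v d}" using u fix_u by (auto simp: E_def)
  ultimately have "E = carrier_vec d" using irr by auto
  then show ?thesis using g
    by (intro mat_eq_of_mult_vec[of _ d d]) (auto simp: E_def)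
qed

text \<open>The bound for translates, applied to the line spanned by \<open>v\<close>. In the case
  of equality the translates of that line form a direct sum, so a vanishing sum over the group has a
  vanishing part over \<open>H\<close>; but that part is |H| times \<open>v\<close>.\<close>

lemma dim_le_index_fixed_vector:
  assumes fin: "finite (carrier G)" and H: "subgroup H G"
    and v: "v \<in> carrier_vec d" "v \<noteq> 0\<^sub>v d" and fix_v: "\<And>h. h \<in> H \<Longrightarrow> \<rho> h *\<^sub>v v = v"
  shows "d * card H \<le> card (carrier G)"
    and "vsum d (carrier G) (\<lambda>g. \<rho> g *\<^sub>v v) = 0\<^sub>v d \<Longrightarrow> d * card H < card (carrier G)"
proof -
  define B where "B = mat d 1 (\<lambda>(i, j). v $ i)"
  have B: "B \<in> carrier_mat d 1" by (simp add: B_def)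
  have Bx: "B *\<^sub>v x = x $ 0 \<cdot>\<^sub>v v" if "x \<in> carrier_vec 1" for x
    using that v(1) by (intro eq_vecI) (auto simp: B_def scalar_prod_def mult.commute)
  have range: "w \<in> mat_range B \<longleftrightarrow> (\<exists>c. w = c \<cdot>\<^sub>v v)" for w
  proof
    assume "w \<in> mat_range B"
    then show "\<exists>c. w = c \<cdot>\<^sub>v v" using Bx by (auto simp: mat_range_iff[OF B])
  next
    assume "\<exists>c. w = c \<cdot>\<^sub>v v"
    then obtain c where "w = c \<cdot>\<^sub>v v" by blast
    then show "w \<in> mat_range B"
      unfolding mat_range_iff[OF B] by (intro bexI[of _ "vec 1 (\<lambda>_. c)"]) (simp_all add: Bx)
  qed
  have inj: "injective_mat B"
    unfolding injective_mat_def
  proof (intro ballI impI)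
    fix x assume x: "x \<in> carrier_vec (dim_col B)" "B *\<^sub>v x = 0\<^sub>v (dim_row B)"
    then have x1: "x \<in> carrier_vec 1" using B by simp
    have "x $ 0 \<cdot>\<^sub>v v = 0 \<cdot>\<^sub>v v" using x(2) Bx[OF x1] B v(1) by auto
    then have "x $ 0 = 0" by (rule smult_vec_cancel[OF _ v])
    then show "x = 0\<^sub>v (dim_col B)" using x1 B by (intro eq_vecI) auto
  qed
  have HG: "H \<subseteq> carrier G" by (rule subgroup.subset[OF H])
  have "\<rho> h *\<^sub>v (c \<cdot>\<^sub>v v) = c \<cdot>\<^sub>v v" if "h \<in> H" for h c
    using that subsetD[OF HG that] v(1) fix_v by (simp add: mult_mat_vec[OF rho_carrier])
  then have stab: "\<forall>h\<in>H. \<forall>w\<in>mat_range B. \<rho> h *\<^sub>v w \<in> mat_range B"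
    unfolding Ball_def range by metis
  note * = dim_le_index_mult[OF fin H B inj _ stab, simplified]
  show le: "d * card H \<le> card (carrier G)" using *(1) by simp
  assume 0: "vsum d (carrier G) (\<lambda>g. \<rho> g *\<^sub>v v) = 0\<^sub>v d"
  have "d * card H \<noteq> card (carrier G)"
  proof
    assume eq: "d * card H = card (carrier G)"
    have "v \<in> mat_range B" unfolding range by (rule exI[of _ 1]) simp
    then have "vsum d H (\<lambda>h. \<rho> h *\<^sub>v v) = 0\<^sub>v d"
      using *(2)[of "\<lambda>_. v"] eq 0 by simp
    moreover have "vsum d H (\<lambda>h. \<rho> h *\<^sub>v v) = of_nat (card H) \<cdot>\<^sub>v v"
      using fix_v v(1) by (intro eq_vecI) auto
    ultimately have "of_nat (card H) \<cdot>\<^sub>v v = 0 \<cdot>\<^sub>v v" using v(1) by auto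
    then have "card H = 0" using smult_vec_cancel[OF _ v, of "of_nat (card H)" 0] by simp
    then show False using subgroup.one_closed[OF H] finite_subset[OF HG fin] by auto
  qed
  with le show "d * card H < card (carrier G)" by simp
qed

text \<open>The trivial subgroup fixes every vector. This bound makes the set of degrees finite, so
  that \<open>Max\<close> is meaningful.\<close>

lemma dim_le_order:
  assumes "finite (carrier G)"
  shows "d \<le> card (carrier G)"
proof -
  have "unit_vec d 0 \<noteq> (0\<^sub>v d :: complex vec)" using dim_pos by simp
  then show ?thesis
    using dim_le_index_fixed_vector(1)[OF assms triv_subgroup, of "unit_vec d 0"] by simp
qed

text \<open>If all irreducible \<open>H\<close>-submodules had dimension \<open>d\<close> divided by the index of \<open>H\<close>,
  the representation would be induced from each of them. A class sum, which acts as a scalar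
  \<open>\<gamma>\<close>, preserves such a submodule only through its part in \<open>H\<close>. So \<open>\<gamma>\<close> is the only
  eigenvalue of that part, and comparing traces shows that the character vanishes at every
  \<open>x \<noteq> \<one>\<close>, which is absurd.\<close>

lemma dim_less_index_mult:
  assumes fin: "finite (carrier G)" and H: "subgroup H G"
    and nontriv: "carrier G \<noteq> {\<one>}"
    and core: "\<And>x. x \<in> carrier G \<Longrightarrow> x \<noteq> \<one> \<Longrightarrow> \<exists>g\<in>carrier G. g \<otimes> x \<otimes> inv g \<notin> H"
    and bound: "\<And>k \<sigma>. irr_rep (G\<lparr>carrier := H\<rparr>) k \<sigma> \<Longrightarrow> k \<le> b"
  shows "d * card H < card (carrier G) * b"
proof (rule ccontr)
  assume "\<not> d * card H < card (carrier G) * b"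
  then have large: "card (carrier G) * b \<le> d * card H" by simp
  have HG: "H \<subseteq> carrier G" by (rule subgroup.subset[OF H])
  interpret R: matrix_rep "G\<lparr>carrier := H\<rparr>" d \<rho> by (rule subgroup_rep[OF H])
  have vanish: "mat_trace (\<rho> x) = 0" if x: "x \<in> carrier G" "x \<noteq> \<one>" for x
  proof -
    define K where "K = (\<lambda>g. g \<otimes> x \<otimes> inv g) ` carrier G"
    have KG: "K \<subseteq> carrier G" using x by (auto simp: K_def)
    have Kconj: "g \<otimes> y \<otimes> inv g \<in> K" if g: "g \<in> carrier G" and y: "y \<in> K" for g y
    proof -
      obtain h where h: "h \<in> carrier G" "y = h \<otimes> x \<otimes> inv h" using y by (auto simp: K_def)
      then have "g \<otimes> y \<otimes> inv g = (g \<otimes> h) \<otimes> x \<otimes> inv (g \<otimes> h)"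
        using g x by (simp add: m_assoc inv_mult_group)
      then show ?thesis using g h by (auto simp: K_def)
    qed
    have conj_image: "(\<lambda>y. g \<otimes> y \<otimes> inv g) ` S = S"
      if g: "g \<in> carrier G" and S: "S \<subseteq> K" and closed: "\<And>y. y \<in> S \<Longrightarrow> g \<otimes> y \<otimes> inv g \<in> S" for g S
    proof (rule endo_inj_surj)
      show "finite S" using S KG fin by (meson finite_subset)
      show "(\<lambda>y. g \<otimes> y \<otimes> inv g) ` S \<subseteq> S" using closed by auto
      show "inj_on (\<lambda>y. g \<otimes> y \<otimes> inv g) S"
        using g S KG by (intro inj_onI) (auto simp: subset_iff)
    qed
    have rho_KH: "\<And>y. y \<in> K \<Longrightarrow> \<rho> y \<in> carrier_mat d d" "\<And>y. y \<in> K \<inter> H \<Longrightarrow> \<rho> y \<in> carrier_mat d d"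
      using KG by auto
    define C where "C = msum d K \<rho>"
    define D where "D = msum d (K \<inter> H) \<rho>"
    have C: "C \<in> carrier_mat d d" and D: "D \<in> carrier_mat d d" by (auto simp: C_def D_def)
    have Cv: "C *\<^sub>v v = vsum d K (\<lambda>y. \<rho> y *\<^sub>v v)" and Dv: "D *\<^sub>v v = vsum d (K \<inter> H) (\<lambda>y. \<rho> y *\<^sub>v v)"
      if "v \<in> carrier_vec d" for v
      unfolding C_def D_def using rho_KH that by (auto intro: msum_mult_vec)
    have "C *\<^sub>v (\<rho> g *\<^sub>v v) = \<rho> g *\<^sub>v (C *\<^sub>v v)" if "g \<in> carrier G" "v \<in> carrier_vec d" for g v
      using that vsum_conj_stable[OF KG that(1) conj_image[OF that(1) order_refl Kconj[OF that(1)]] that(2)]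
      by (simp add: Cv)
    then obtain \<gamma> where \<gamma>: "\<And>v. v \<in> carrier_vec d \<Longrightarrow> C *\<^sub>v v = \<gamma> \<cdot>\<^sub>v v"
      using schur[OF C] by blast
    \<comment> \<open>The part of the class in \<open>H\<close> is in general invariant under
      conjugation by \<open>H\<close> only, so \<open>D\<close> commutes with \<open>H\<close> and
      its eigenspaces are \<open>H\<close>-stable.\<close>
    have Dcomm: "D *\<^sub>v (\<rho> h *\<^sub>v v) = \<rho> h *\<^sub>v (D *\<^sub>v v)" if h: "h \<in> H" and v: "v \<in> carrier_vec d" for h v
    proof -
      have hG: "h \<in> carrier G" using h HG by auto
      have "h \<otimes> y \<otimes> inv h \<in> K \<inter> H" if "y \<in> K \<inter> H" for y
        using that Kconj[OF hG, of y] h subgroup.m_closed[OF H] subgroup.m_inv_closed[OF H] by auto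
      then have "(\<lambda>y. h \<otimes> y \<otimes> inv h) ` (K \<inter> H) = K \<inter> H"
        using conj_image[OF hG, of "K \<inter> H"] by blast
      from vsum_conj_stable[OF _ hG this v] KG show ?thesis
        using v hG by (simp add: Dv le_infI1)
    qed
    have ev: "\<mu> = \<gamma>" if v: "v \<in> carrier_vec d" "v \<noteq> 0\<^sub>v d" "D *\<^sub>v v = \<mu> \<cdot>\<^sub>v v" for \<mu> v
    proof -
      define E where "E = {v \<in> carrier_vec d. D *\<^sub>v v = \<mu> \<cdot>\<^sub>v v}"
      have E: "lin_subspace d E" unfolding E_def by (rule lin_subspace_eigenspace[OF D])
      have E_stable: "R.stable E"
        using HG by (auto simp: R.stable_def E_def Dcomm mult_mat_vec[OF rho_carrier] subset_iff)
      have E_nz: "E \<noteq> {0\<^sub>v d}" using v by (auto simp: E_def)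
      obtain k B \<sigma> where B: "B \<in> carrier_mat d k" "injective_mat B" "0 < k" "mat_range B \<subseteq> E"
        and \<sigma>: "irr_rep (G\<lparr>carrier := H\<rparr>) k \<sigma>" "\<And>h. h \<in> carrier (G\<lparr>carrier := H\<rparr>) \<Longrightarrow> \<rho> h * B = B * \<sigma> h"
        by (rule R.irreducible_subrep[OF E E_stable E_nz]) (rule that)
      interpret S: irr_rep "G\<lparr>carrier := H\<rparr>" k \<sigma> by (rule \<sigma>(1))
      have "\<rho> h *\<^sub>v w \<in> mat_range B" if h: "h \<in> H" and w: "w \<in> mat_range B" for h w
      proof -
        obtain y where y: "y \<in> carrier_vec k" "w = B *\<^sub>v y" using w mat_range_iff[OF B(1)] by auto
        have \<sigma>h: "\<sigma> h \<in> carrier_mat k k" using S.rho_carrier[of h] h by simp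
        have "\<rho> h *\<^sub>v w = B *\<^sub>v (\<sigma> h *\<^sub>v y)"
          using assoc_mult_mat_vec[OF rho_carrier B(1) y(1), of h] assoc_mult_mat_vec[OF B(1) \<sigma>h y(1)]
            \<sigma>(2)[of h] h HG y(2) by auto
        then show ?thesis
          unfolding mat_range_iff[OF B(1)] using \<sigma>h y by (intro bexI[of _ "\<sigma> h *\<^sub>v y"]) auto
      qed
      then have "\<forall>h\<in>H. \<forall>w\<in>mat_range B. \<rho> h *\<^sub>v w \<in> mat_range B" by blast
      note * = dim_le_index_mult[OF fin H B(1,2,3) this]
      \<comment> \<open>The supposed failure gives one inequality, since \<open>k \<le> b\<close>;
        spanning by translates gives the other.\<close>
      have eq: "d * card H = card (carrier G) * k"
        using *(1) large bound[OF \<sigma>(1)] by (meson le_antisym le_trans mult_le_mono2)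
      define u where "u = B *\<^sub>v unit_vec k 0"
      have u0: "u \<noteq> 0\<^sub>v d"
        using injective_matD[OF B(2,1), of "unit_vec k 0"] B(3) by (auto simp: u_def)
      have uB: "u \<in> mat_range B"
        unfolding mat_range_iff[OF B(1)] u_def by (rule bexI[of _ "unit_vec k 0"]) simp_all
      have uE: "u \<in> E" using uB B(4) by auto
      then have u: "u \<in> carrier_vec d" by (auto simp: E_def)
      \<comment> \<open>The coefficients of the class sum minus \<gamma> times the identity, an
        element of the group algebra, each multiplied with \<open>u\<close>. Summed over the group
        this yields C u - \<gamma> u = 0; summed over \<open>H\<close> it yields D u - \<gamma> u =
        (\<mu> - \<gamma>) u.\<close>
      define w where "w g = ((if g \<in> K then 1 else 0) - (if g = \<one> then \<gamma> else 0)) \<cdot>\<^sub>v u" for g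
      have sum_w: "vsum d S (\<lambda>g. \<rho> g *\<^sub>v w g) = vsum d (K \<inter> S) (\<lambda>y. \<rho> y *\<^sub>v u) - \<gamma> \<cdot>\<^sub>v u"
        if S: "S \<subseteq> carrier G" "\<one> \<in> S" for S
      proof (rule eq_vecI)
        fix r assume "r < dim_vec (vsum d (K \<inter> S) (\<lambda>y. \<rho> y *\<^sub>v u) - \<gamma> \<cdot>\<^sub>v u)"
        then have r: "r < d" using u by simp
        have finS: "finite S" using S(1) fin by (rule finite_subset)
        have "(\<rho> g *\<^sub>v w g) $ r =
            (if g \<in> K then (\<rho> g *\<^sub>v u) $ r else 0) - (if g = \<one> then \<gamma> * u $ r else 0)" if "g \<in> S" for g
        proof -
          have g: "g \<in> carrier G" using that S by auto
          have "(\<rho> g *\<^sub>v w g) $ r =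
              ((if g \<in> K then 1 else 0) - (if g = \<one> then \<gamma> else 0)) * (\<rho> g *\<^sub>v u) $ r"
            unfolding w_def mult_mat_vec[OF rho_carrier[OF g] u]
            using r carrier_matD(1)[OF rho_carrier[OF g]] by (simp del: index_mult_mat_vec)
          then show ?thesis using u by (auto simp: left_diff_distrib simp del: index_mult_mat_vec)
        qed
        then have "vsum d S (\<lambda>g. \<rho> g *\<^sub>v w g) $ r =
            (\<Sum>g\<in>S. if g \<in> K then (\<rho> g *\<^sub>v u) $ r else 0) - (\<Sum>g\<in>S. if g = \<one> then \<gamma> * u $ r else 0)"
          using r by (simp add: sum_subtractf del: index_mult_mat_vec)
        also have "(\<Sum>g\<in>S. if g \<in> K then (\<rho> g *\<^sub>v u) $ r else 0) = (\<Sum>g\<in>K \<inter> S. (\<rho> g *\<^sub>v u) $ r)"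
          using sum.inter_restrict[OF finS, of "\<lambda>g. (\<rho> g *\<^sub>v u) $ r" K] by (simp add: Int_commute)
        finally show "vsum d S (\<lambda>g. \<rho> g *\<^sub>v w g) $ r =
            (vsum d (K \<inter> S) (\<lambda>y. \<rho> y *\<^sub>v u) - \<gamma> \<cdot>\<^sub>v u) $ r"
          using r u finS S(2) by (simp del: index_mult_mat_vec)
      qed (use u in simp)
      have "vsum d (carrier G) (\<lambda>g. \<rho> g *\<^sub>v w g) = 0\<^sub>v d"
        using sum_w[of "carrier G"] Cv[OF u] \<gamma>[OF u] KG u by (simp add: Int_absorb2)
      moreover have "w g \<in> mat_range B" for g
        using lin_subspace_mat_range[OF B(1)] uB by (auto simp: w_def lin_subspace_def)
      ultimately have "vsum d H (\<lambda>g. \<rho> g *\<^sub>v w g) = 0\<^sub>v d" using *(2)[OF eq] by blast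
      then have 0: "\<mu> \<cdot>\<^sub>v u - \<gamma> \<cdot>\<^sub>v u = 0\<^sub>v d"
        using sum_w[OF HG subgroup.one_closed[OF H]] Dv[OF u] uE by (simp add: E_def)
      have "\<mu> \<cdot>\<^sub>v u = \<gamma> \<cdot>\<^sub>v u"
      proof (rule eq_vecI)
        fix r assume "r < dim_vec (\<gamma> \<cdot>\<^sub>v u)"
        then show "(\<mu> \<cdot>\<^sub>v u) $ r = (\<gamma> \<cdot>\<^sub>v u) $ r"
          using arg_cong[OF 0, of "\<lambda>v. v $ r"] u by simp
      qed simp
      then show "\<mu> = \<gamma>" by (rule smult_vec_cancel[OF _ u u0])
    qed
    have class_sum: "mat_trace (msum d S \<rho>) = of_nat (card S) * mat_trace (\<rho> x)" if "S \<subseteq> K" for S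
    proof -
      have "mat_trace (\<rho> y) = mat_trace (\<rho> x)" if "y \<in> K" for y
        using that mat_trace_conj x by (auto simp: K_def)
      then have "(\<Sum>y\<in>S. mat_trace (\<rho> y)) = (\<Sum>y\<in>S. mat_trace (\<rho> x))"
        using \<open>S \<subseteq> K\<close> by (intro sum.cong) auto
      then show ?thesis
        using rho_KH(1) \<open>S \<subseteq> K\<close> by (subst mat_trace_msum) (auto simp: subset_iff)
    qed
    \<comment> \<open>Both traces equal d \<gamma>, yet they are |K| and |K \<inter> H| times the
      same character value. The two cardinalities differ because some conjugate of \<open>x\<close>
      lies outside \<open>H\<close>, so the value is 0.\<close>
    have "mat_trace C = of_nat d * \<gamma>"
      using smult_vec_cancel \<gamma> by (intro mat_trace_single_eigenvalue[OF C]) metis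
    moreover have "mat_trace D = of_nat d * \<gamma>"
      using ev by (intro mat_trace_single_eigenvalue[OF D])
    moreover have "mat_trace C = of_nat (card K) * mat_trace (\<rho> x)"
      unfolding C_def by (rule class_sum) simp
    moreover have "mat_trace D = of_nat (card (K \<inter> H)) * mat_trace (\<rho> x)"
      unfolding D_def by (rule class_sum) simp
    moreover have "card (K \<inter> H) < card K"
    proof (rule psubset_card_mono)
      show "finite K" using KG fin by (rule finite_subset)
      show "K \<inter> H \<subset> K" using core[OF x] by (auto simp: K_def)
    qed
    ultimately have "of_nat (card K) * mat_trace (\<rho> x) = of_nat (card (K \<inter> H)) * mat_trace (\<rho> x)"
      "card K \<noteq> card (K \<inter> H)" by auto
    then show ?thesis by simp
  qed
  obtain x where x: "x \<in> carrier G" "x \<noteq> \<one>" using nontriv by auto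
  have one: "mat_trace (1\<^sub>m d) = of_nat d" by (simp add: mat_trace_def)
  define S where "S = msum d (carrier G) \<rho>"
  have S: "S \<in> carrier_mat d d" by (simp add: S_def)
  have Sv: "S *\<^sub>v v = vsum d (carrier G) (\<lambda>g. \<rho> g *\<^sub>v v)" if "v \<in> carrier_vec d" for v
    unfolding S_def using that by (intro msum_mult_vec) auto
  have "mat_trace S = (\<Sum>g\<in>carrier G. if g = \<one> then of_nat d else 0)"
    unfolding S_def using vanish one by (subst mat_trace_msum) (auto intro!: sum.cong)
  then have "mat_trace S = of_nat d" using fin by simp
  have "\<exists>v\<in>carrier_vec d. S *\<^sub>v v \<noteq> 0\<^sub>v d"
  proof (rule ccontr)
    assume "\<not> (\<exists>v\<in>carrier_vec d. S *\<^sub>v v \<noteq> 0\<^sub>v d)"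
    then have S0: "S *\<^sub>v v = 0 \<cdot>\<^sub>v v" if "v \<in> carrier_vec d" for v using that by auto
    have "mat_trace S = of_nat d * 0"
      using S0 smult_vec_cancel by (intro mat_trace_single_eigenvalue[OF S]) metis
    with \<open>mat_trace S = of_nat d\<close> dim_pos show False by simp
  qed
  then obtain v where v: "v \<in> carrier_vec d" "S *\<^sub>v v \<noteq> 0\<^sub>v d" by blast
  have "\<rho> x = 1\<^sub>m d"
    using fixed_vector_trivial[OF _ v(2)] vsum_carrier_fixed v x by (simp add: Sv)
  with vanish[OF x] one dim_pos show False by simp
qed

end

text \<open>The eigenvalues of \<open>\<rho> g\<close> are roots of unity, so a trace of \<open>d\<close> forces them to be \<open>1\<close>.
  Then the sum of the powers of \<open>\<rho> g\<close> has no kernel, while it annihilates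
  \<open>\<rho> g v - v\<close>.\<close>

lemma (in matrix_rep) trace_eq_dim_imp_one:
  assumes fin: "finite (carrier G)" and g: "g \<in> carrier G" and tr: "mat_trace (\<rho> g) = of_nat d"
  shows "\<rho> g = 1\<^sub>m d"
proof (rule ccontr)
  assume ne: "\<rho> g \<noteq> 1\<^sub>m d"
  define N where "N = Coset.order G"
  have N: "0 < N" "g [^] N = \<one>"
    using fin g pow_order_eq_1[OF g] order_gt_0_iff_finite by (auto simp: N_def)
  have pow_ev: "\<rho> (g [^] n) *\<^sub>v v = e ^ n \<cdot>\<^sub>v v"
    if "v \<in> carrier_vec d" "\<rho> g *\<^sub>v v = e \<cdot>\<^sub>v v" for v e and n :: nat
  proof (induction n)
    case 0
    show ?case using that by simp
  next
    case (Suc n)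
    have "\<rho> (g [^] Suc n) *\<^sub>v v = \<rho> (g [^] n) *\<^sub>v (\<rho> g *\<^sub>v v)"
      using that(1) g by (simp add: rho_mult_vec)
    also have "\<dots> = e \<cdot>\<^sub>v (e ^ n \<cdot>\<^sub>v v)"
      using that g Suc by (simp add: mult_mat_vec[OF rho_carrier])
    finally show ?case by (simp add: smult_smult_assoc)
  qed
  obtain es where es: "length es = d" "mat_trace (\<rho> g) = sum_list es"
    "\<And>e. e \<in> set es \<longleftrightarrow> (\<exists>v\<in>carrier_vec d. v \<noteq> 0\<^sub>v d \<and> \<rho> g *\<^sub>v v = e \<cdot>\<^sub>v v)"
    using mat_trace_eigenvalues[OF rho_carrier[OF g]] by blast
  have root: "norm e = 1" if "e \<in> set es" for e
  proof -
    obtain v where v: "v \<in> carrier_vec d" "v \<noteq> 0\<^sub>v d" "\<rho> g *\<^sub>v v = e \<cdot>\<^sub>v v"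
      using \<open>e \<in> set es\<close> es(3) by blast
    have "e ^ N \<cdot>\<^sub>v v = 1 \<cdot>\<^sub>v v" using pow_ev[OF v(1,3), of N] N v by simp
    then have "e ^ N = 1" by (rule smult_vec_cancel[OF _ v(1,2)])
    then show ?thesis using N(1) by (metis norm_one norm_power power_eq_1_iff gr_implies_not0 norm_ge_zero)
  qed
  have Re_le: "Re e \<le> 1" if "e \<in> set es" for e
    using complex_Re_le_cmod[of e] root[OF that] by simp
  have Re_sum: "Re (sum_list es) = (\<Sum>e\<leftarrow>es. Re e)" by (induction es) auto
  \<comment> \<open>The \<open>d\<close> real parts, each at most 1, add up to \<open>d\<close>, so
    each is 1; modulus 1 then removes the imaginary part.\<close>
  have all1: "e = 1" if "e \<in> set es" for e
  proof -
    have "(\<Sum>e\<leftarrow>es. 1 - Re e) = 0"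
      using tr es(1,2) Re_sum by (simp add: sum_list_subtractf sum_list_triv)
    then have "\<forall>x\<in>set (map (\<lambda>e. 1 - Re e) es). x = 0"
      by (subst (asm) sum_list_nonneg_eq_0_iff) (use Re_le in auto)
    then have "1 - Re e = 0" using that by simp
    then have "Re e = 1" by simp
    with root[OF that] have "Im e = 0" by (simp add: cmod_def)
    with \<open>Re e = 1\<close> show ?thesis by (simp add: complex_eq_iff)
  qed
  define S where "S = msum d {..<N} (\<lambda>n. \<rho> (g [^] n))"
  have S: "S \<in> carrier_mat d d" by (simp add: S_def)
  have Sv: "S *\<^sub>v v = vsum d {..<N} (\<lambda>n. \<rho> (g [^] n) *\<^sub>v v)" if "v \<in> carrier_vec d" for v
    unfolding S_def using that g by (intro msum_mult_vec) auto
  obtain v where v: "v \<in> carrier_vec d" "\<rho> g *\<^sub>v v \<noteq> v"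
    using ne mat_eq_of_mult_vec[OF rho_carrier[OF g] one_carrier_mat] by auto
  \<comment> \<open>The two sums differ by their end terms, with exponents \<open>N\<close> and 0,
    which agree because \<open>g [^] N = \<one>\<close>.\<close>
  have shift: "vsum d {..<N} (\<lambda>n. \<rho> (g [^] Suc n) *\<^sub>v w) = vsum d {..<N} (\<lambda>n. \<rho> (g [^] n) *\<^sub>v w)"
    if w: "w \<in> carrier_vec d" for w
  proof (rule eq_vecI)
    fix r assume "r < dim_vec (vsum d {..<N} (\<lambda>n. \<rho> (g [^] n) *\<^sub>v w))"
    then have r: "r < d" by simp
    have "(\<Sum>n<N. (\<rho> (g [^] Suc n) *\<^sub>v w) $ r) - (\<Sum>n<N. (\<rho> (g [^] n) *\<^sub>v w) $ r) =
        (\<rho> (g [^] N) *\<^sub>v w) $ r - (\<rho> (g [^] (0::nat)) *\<^sub>v w) $ r"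
      unfolding sum_subtractf[symmetric] by (rule sum_lessThan_telescope)
    also have "\<dots> = 0" using N(2) by simp
    finally show "vsum d {..<N} (\<lambda>n. \<rho> (g [^] Suc n) *\<^sub>v w) $ r = vsum d {..<N} (\<lambda>n. \<rho> (g [^] n) *\<^sub>v w) $ r"
      using r by (simp del: index_mult_mat_vec nat_pow_Suc)
  qed simp
  have gv: "\<rho> g *\<^sub>v v \<in> carrier_vec d" using v g by simp
  have Sg: "S *\<^sub>v (\<rho> g *\<^sub>v w) = S *\<^sub>v w" if w: "w \<in> carrier_vec d" for w
  proof -
    have "S *\<^sub>v (\<rho> g *\<^sub>v w) = vsum d {..<N} (\<lambda>n. \<rho> (g [^] Suc n) *\<^sub>v w)"
      using w g by (subst Sv) (auto intro!: vsum_cong simp: rho_mult_vec)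
    then show ?thesis using shift[OF w] Sv[OF w] by simp
  qed
  \<comment> \<open>The kernel of \<open>S\<close>, written as the eigenspace for 0. It is invariant
    under \<open>\<rho> g\<close>, so once it is nonzero it contains an eigenvector; the eigenvalue
    is 1, and there \<open>S\<close> acts as multiplication by \<open>N\<close>.\<close>
  define U where "U = {u \<in> carrier_vec d. S *\<^sub>v u = 0 \<cdot>\<^sub>v u}"
  have U: "lin_subspace d U" unfolding U_def by (rule lin_subspace_eigenspace[OF S])
  have zero: "0 \<cdot>\<^sub>v u = 0\<^sub>v d" if "u \<in> carrier_vec d" for u :: "complex vec" using that by auto
  have "\<rho> g *\<^sub>v v - v \<in> U"
    using v gv Sg[OF v(1)] zero[of "\<rho> g *\<^sub>v v - v"]
    by (simp add: U_def mult_minus_distrib_mat_vec[OF S gv v(1)] del: index_mult_mat_vec)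
       (use S in auto)
  moreover have "\<rho> g *\<^sub>v v - v \<noteq> 0\<^sub>v d"
  proof
    assume 0: "\<rho> g *\<^sub>v v - v = 0\<^sub>v d"
    have "\<rho> g *\<^sub>v v = v"
    proof (rule eq_vecI)
      fix r assume "r < dim_vec v"
      then show "(\<rho> g *\<^sub>v v) $ r = v $ r"
        using arg_cong[OF 0, of "\<lambda>v. v $ r"] v(1) by (simp del: index_mult_mat_vec)
    qed (use v carrier_matD(1)[OF rho_carrier[OF g]] in simp)
    with v(2) show False ..
  qed
  ultimately have U_nz: "U \<noteq> {0\<^sub>v d}" by blast
  have U_inv: "\<rho> g *\<^sub>v u \<in> U" if "u \<in> U" for u
    using that g Sg zero by (auto simp: U_def)
  obtain c u where u: "u \<in> U" "u \<noteq> 0\<^sub>v d" "\<rho> g *\<^sub>v u = c \<cdot>\<^sub>v u"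
    by (rule eigenvector_in_subspace[OF rho_carrier[OF g] U U_nz]) (erule U_inv, rule that)
  have ud: "u \<in> carrier_vec d" using u(1) by (simp add: U_def)
  have "c = 1" using all1 es(3) u ud by blast
  then have "\<rho> (g [^] n) *\<^sub>v u = u" for n :: nat using pow_ev[OF ud u(3), of n] by simp
  then have "S *\<^sub>v u = of_nat N \<cdot>\<^sub>v u" using ud by (auto simp: Sv)
  then have "of_nat N \<cdot>\<^sub>v u = 0 \<cdot>\<^sub>v u" using u(1) by (simp add: U_def)
  then have "of_nat N = (0 :: complex)" by (rule smult_vec_cancel[OF _ ud u(2)])
  with N(1) show False by simp
qed

section \<open>Irreducible characters, maximal degrees and codegrees\<close>

lemma Irr_iff:
  assumes "group G"
  shows "\<chi> \<in> Irr G \<longleftrightarrow> (\<exists>d \<rho>. irr_rep G d \<rho> \<and> \<chi> = character_of G d \<rho>)"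
  by (auto simp: Irr_def irreducible_representation_iff[OF assms])

lemma (in matrix_rep) character_of_eq_trace:
  "g \<in> carrier G \<Longrightarrow> character_of G d \<rho> g = mat_trace (\<rho> g)"
  using carrier_matD(1)[OF rho_carrier, of g] by (simp add: character_of_def mat_trace_def)

lemma (in matrix_rep) character_degree: "character_degree G (character_of G d \<rho>) = real d"
  by (simp add: character_degree_def character_of_eq_trace) (simp add: mat_trace_def)

text \<open>The trace of \<open>\<rho> g\<close> reaches \<open>d\<close> only at the identity
  matrix, so the kernel read off from character values is the kernel of a homomorphism.\<close>

lemma (in matrix_rep) character_kernel:
  assumes "finite (carrier G)"
  shows "character_kernel G (character_of G d \<rho>) = {g \<in> carrier G. \<rho> g = 1\<^sub>m d}"
proof -
  have one: "mat_trace (1\<^sub>m d) = of_nat d" by (simp add: mat_trace_def)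
  have "mat_trace (\<rho> g) = mat_trace (1\<^sub>m d) \<longleftrightarrow> \<rho> g = 1\<^sub>m d" if "g \<in> carrier G" for g
    using trace_eq_dim_imp_one[OF assms that] by (auto simp: one)
  then show ?thesis
    unfolding character_kernel_def
    by (intro Collect_cong conj_cong refl) (simp add: character_of_eq_trace)
qed

lemma (in matrix_rep) kernel_normal: "{g \<in> carrier G. \<rho> g = 1\<^sub>m d} \<lhd> G"
proof -
  have inv: "\<rho> (inv g) = 1\<^sub>m d" if "g \<in> carrier G" "\<rho> g = 1\<^sub>m d" for g
    using rho_mult[of g "inv g"] that left_mult_one_mat[OF rho_carrier, of "inv g"] by simp
  have sub: "subgroup {g \<in> carrier G. \<rho> g = 1\<^sub>m d} G"
    using inv by (intro subgroupI) (auto simp: rho_mult)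
  have "\<rho> (x \<otimes> h \<otimes> inv x) = 1\<^sub>m d" if "x \<in> carrier G" "h \<in> carrier G" "\<rho> h = 1\<^sub>m d" for x h
    using that right_mult_one_mat[OF rho_carrier, of x] rho_mult[of x "inv x"] by (simp add: rho_mult)
  then show ?thesis using sub by (auto simp: normal_inv_iff)
qed

lemma (in group) max_degree_attained:
  assumes fin: "finite (carrier G)"
  obtains b \<rho> where "max_degree G = real b" "irr_rep G b \<rho>" "\<And>k \<sigma>. irr_rep G k \<sigma> \<Longrightarrow> k \<le> b"
proof -
  define D where "D = {d. \<exists>\<rho>. irr_rep G d \<rho>}"
  have img: "character_degree G ` Irr G = real ` D"
  proof (intro equalityI subsetI)
    fix x assume "x \<in> character_degree G ` Irr G"
    then obtain d \<rho> where \<rho>: "irr_rep G d \<rho>" "x = character_degree G (character_of G d \<rho>)"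
      by (auto simp: Irr_iff[OF group_axioms])
    then interpret irr_rep G d \<rho> by simp
    show "x \<in> real ` D" using \<rho> character_degree by (auto simp: D_def)
  next
    fix x assume "x \<in> real ` D"
    then obtain d \<rho> where \<rho>: "irr_rep G d \<rho>" "x = real d" by (auto simp: D_def)
    then interpret irr_rep G d \<rho> by simp
    have "character_of G d \<rho> \<in> Irr G" using \<rho> by (auto simp: Irr_iff[OF group_axioms])
    then show "x \<in> character_degree G ` Irr G" using \<rho>(2) character_degree by force
  qed
  have "D \<subseteq> {..card (carrier G)}" using irr_rep.dim_le_order[OF _ fin] by (auto simp: D_def)
  then have finD: "finite D" by (rule finite_subset) simp
  \<comment> \<open>The one-dimensional trivial representation shows that some degree
    exists.\<close>
  interpret T: matrix_rep G 1 "\<lambda>_. 1\<^sub>m 1" by unfold_locales auto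
  have "(carrier_vec 1 :: complex vec set) \<noteq> {0\<^sub>v 1}"
  proof
    assume "(carrier_vec 1 :: complex vec set) = {0\<^sub>v 1}"
    then have "unit_vec 1 0 = (0\<^sub>v 1 :: complex vec)" by (metis singletonD unit_vec_carrier)
    then show False by simp
  qed
  moreover have "lin_subspace 1 (carrier_vec 1)" by (simp add: lin_subspace_def)
  moreover have "T.stable (carrier_vec 1)" unfolding T.stable_def by auto
  ultimately obtain k \<sigma> where "irr_rep G k \<sigma>"
    using T.irreducible_subrep[of "carrier_vec 1"] by metis
  then have "D \<noteq> {}" by (auto simp: D_def)
  have "max_degree G = real (Max D)"
    unfolding max_degree_def img using mono_Max_commute[of real D] finD \<open>D \<noteq> {}\<close>
    by (simp add: mono_def)
  moreover have "Max D \<in> D" using finD \<open>D \<noteq> {}\<close> by (rule Max_in)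
  moreover have "k \<le> Max D" if "irr_rep G k \<sigma>" for k \<sigma>
    using that finD by (intro Max_ge) (auto simp: D_def)
  ultimately show thesis using that by (auto simp: D_def)
qed

text \<open>The strict bound b(G) |H| < |G| b(H), divided by b(G) b(H).\<close>

theorem (in group) order_over_max_degree_less:
  assumes fin: "finite (carrier G)" and H: "subgroup H G"
    and nontriv: "carrier G \<noteq> {\<one>}"
    and core: "\<And>x. x \<in> carrier G \<Longrightarrow> x \<noteq> \<one> \<Longrightarrow> \<exists>g\<in>carrier G. g \<otimes> x \<otimes> inv g \<notin> H"
  shows "order_over_max_degree (G\<lparr>carrier := H\<rparr>) < order_over_max_degree G"
proof -
  interpret H: group "G\<lparr>carrier := H\<rparr>" by (rule subgroup.subgroup_is_group[OF H group_axioms])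
  have finH: "finite (carrier (G\<lparr>carrier := H\<rparr>))"
    using finite_subset[OF subgroup.subset[OF H] fin] by simp
  obtain d \<rho> where d: "max_degree G = real d" "irr_rep G d \<rho>"
    using max_degree_attained[OF fin] by metis
  obtain b \<sigma> where b: "max_degree (G\<lparr>carrier := H\<rparr>) = real b" "irr_rep (G\<lparr>carrier := H\<rparr>) b \<sigma>"
    "\<And>k \<sigma>. irr_rep (G\<lparr>carrier := H\<rparr>) k \<sigma> \<Longrightarrow> k \<le> b"
    using H.max_degree_attained[OF finH] by blast
  interpret irr_rep G d \<rho> by (rule d(2))
  have "d * card H < card (carrier G) * b"
    by (rule dim_less_index_mult[OF fin H nontriv]) (erule (1) core, erule b(3))
  then have "real d * real (card H) < real (card (carrier G)) * real b"
    by (metis of_nat_less_iff of_nat_mult)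
  then show ?thesis
    using dim_pos irr_rep.dim_pos[OF b(2)]
    by (simp add: order_over_max_degree_def d(1) b(1) divide_simps mult.commute)
qed

text \<open>Any vector is fixed by the kernel N, and the sum of its images under the whole group is
  a fixed vector, which must be 0 for a nontrivial representation. The strict fixed-vector bound
  then gives d < |G : N|, which is the first claim.\<close>

lemma (in irr_rep) codegree_character_of:
  assumes fin: "finite (carrier G)" and nontriv: "x \<in> carrier G" "\<rho> x \<noteq> 1\<^sub>m d"
  shows "1 < codegree G (character_of G d \<rho>)"
    and "codegree G (character_of G d \<rho>) \<le> real (card (carrier G)) / real d"
    and "{g \<in> carrier G. \<rho> g = 1\<^sub>m d} = {\<one>} \<Longrightarrow>
      codegree G (character_of G d \<rho>) = real (card (carrier G)) / real d"
proof -
  define N where "N = {g \<in> carrier G. \<rho> g = 1\<^sub>m d}"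
  have N: "subgroup N G" unfolding N_def using kernel_normal normal_imp_subgroup by blast
  define r where "r = card (rcosets N)"
  have r: "r * card N = card (carrier G)"
    using lagrange[OF N] by (simp add: r_def Coset.order_def)
  have finN: "finite N" using fin by (simp add: N_def)
  have N1: "0 < card N" using finN subgroup.one_closed[OF N] by (auto simp: card_gt_0_iff)
  have cod: "codegree G (character_of G d \<rho>) = real r / real d"
    by (simp add: codegree_def character_kernel[OF fin] character_degree r_def N_def)
  define v where "v = (unit_vec d 0 :: complex vec)"
  have v: "v \<in> carrier_vec d" "v \<noteq> 0\<^sub>v d" using dim_pos by (auto simp: v_def)
  have "vsum d (carrier G) (\<lambda>g. \<rho> g *\<^sub>v v) = 0\<^sub>v d"
    using fixed_vector_trivial[OF vsum_carrier] vsum_carrier_fixed[OF _ v(1)] nontriv by blast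
  then have "d * card N < card (carrier G)"
    using v by (intro dim_le_index_fixed_vector(2)[OF fin N v]) (auto simp: N_def)
  then have "d < r" unfolding r[symmetric] by simp
  then show "1 < codegree G (character_of G d \<rho>)" using dim_pos by (simp add: cod)
  have "r \<le> card (carrier G)" unfolding r[symmetric] using N1 by simp
  then show "codegree G (character_of G d \<rho>) \<le> real (card (carrier G)) / real d"
    by (simp add: cod divide_right_mono)
  assume "{g \<in> carrier G. \<rho> g = 1\<^sub>m d} = {\<one>}"
  then have "card N = 1" by (simp add: N_def)
  then show "codegree G (character_of G d \<rho>) = real (card (carrier G)) / real d"
    using r by (simp add: cod)
qed

lemma (in group) small_codegree_exists:
  assumes fin: "finite (carrier G)"
    and \<sigma>: "irr_rep G k \<sigma>" "x \<in> carrier G" "\<sigma> x \<noteq> 1\<^sub>m k"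
  shows "\<exists>c\<in>codegrees G. 1 < c \<and> c \<le> order_over_max_degree G"
proof -
  obtain b \<rho> where b: "max_degree G = real b" "irr_rep G b \<rho>" "\<And>k \<sigma>. irr_rep G k \<sigma> \<Longrightarrow> k \<le> b"
    using max_degree_attained[OF fin] by metis
  have *: "\<exists>c\<in>codegrees G. 1 < c \<and> c \<le> order_over_max_degree G"
    if \<tau>: "irr_rep G b \<tau>" "x \<in> carrier G" "\<tau> x \<noteq> 1\<^sub>m b" for \<tau> x
  proof -
    interpret irr_rep G b \<tau> by (rule \<tau>(1))
    have "character_of G b \<tau> \<in> Irr G" using \<tau>(1) by (auto simp: Irr_iff[OF group_axioms])
    then show ?thesis
      using codegree_character_of(1,2)[OF fin \<tau>(2,3)] by (auto simp: codegrees_def order_over_max_degree_def b(1))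
  qed
  show ?thesis
  proof (cases "\<exists>x\<in>carrier G. \<rho> x \<noteq> 1\<^sub>m b")
    case True
    then show ?thesis using *[OF b(2)] by blast
  next
    \<comment> \<open>Here \<open>\<rho>\<close> is trivial, so every vector is fixed by the whole
      group and \<open>b \<le> 1\<close>. The given nontrivial \<open>\<sigma>\<close> therefore has
      maximal degree too and replaces \<open>\<rho>\<close>.\<close>
    case False
    interpret irr_rep G b \<rho> by (rule b(2))
    have "unit_vec b 0 \<noteq> (0\<^sub>v b :: complex vec)" using dim_pos by simp
    then have "b * card (carrier G) \<le> card (carrier G)"
      using False by (intro dim_le_index_fixed_vector(1)[OF fin subgroup_self, of "unit_vec b 0"]) auto
    then have "b \<le> 1" using fin by (auto simp: card_gt_0_iff)
    moreover have "k \<le> b" "0 < k" using b(3)[OF \<sigma>(1)] irr_rep.dim_pos[OF \<sigma>(1)] by auto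
    ultimately have "k = b" by simp
    then show ?thesis using *[of \<sigma>] \<sigma> by blast
  qed
qed

text \<open>Only two kernels are possible: the trivial one, where the codegree is |G| / d with d at
  most the maximal degree, and the whole group, where the index is 1 and the codegree 1 / d.\<close>

lemma (in group) codegree_simple_ge:
  assumes fin: "finite (carrier G)" and simple: "\<And>N. N \<lhd> G \<Longrightarrow> N = {\<one>} \<or> N = carrier G"
    and c: "c \<in> codegrees G"
  shows "c \<le> 1 \<or> order_over_max_degree G \<le> c"
proof -
  obtain b \<rho> where b: "max_degree G = real b" "irr_rep G b \<rho>" "\<And>k \<sigma>. irr_rep G k \<sigma> \<Longrightarrow> k \<le> b"
    using max_degree_attained[OF fin] by metis
  obtain d \<tau> where d: "irr_rep G d \<tau>" "c = codegree G (character_of G d \<tau>)"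
    using c by (auto simp: codegrees_def Irr_iff[OF group_axioms])
  interpret irr_rep G d \<tau> by (rule d(1))
  show ?thesis
  proof (cases "\<exists>x\<in>carrier G. \<tau> x \<noteq> 1\<^sub>m d")
    case True
    then obtain x where x: "x \<in> carrier G" "\<tau> x \<noteq> 1\<^sub>m d" by blast
    then have "{g \<in> carrier G. \<tau> g = 1\<^sub>m d} = {\<one>}" using simple[OF kernel_normal] by blast
    then have "c = real (card (carrier G)) / real d"
      using codegree_character_of(3)[OF fin x] d(2) by simp
    then show ?thesis
      using b(3)[OF d(1)] dim_pos by (simp add: order_over_max_degree_def b(1) frac_le)
  next
    case False
    then have "{g \<in> carrier G. \<tau> g = 1\<^sub>m d} = carrier G" by auto
    moreover have "card (rcosets (carrier G)) * card (carrier G) = card (carrier G)"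
      using lagrange[OF subgroup_self] by (simp add: Coset.order_def)
    then have "card (rcosets (carrier G)) = 1" using fin by (auto simp: card_gt_0_iff)
    ultimately have "c = 1 / real d"
      by (simp add: d(2) codegree_def character_kernel[OF fin] character_degree)
    then show ?thesis using dim_pos by simp
  qed
qed

section \<open>Alternating groups\<close>

lemma evenperm_comp_transpose:
  assumes "permutation p"
  shows "evenperm (Transposition.transpose a b \<circ> p) \<longleftrightarrow> (a = b \<longleftrightarrow> evenperm p)"
  using assms by (simp add: evenperm_comp permutation_swap_id evenperm_swap)

lemma alt_group_comp_transpose:
  assumes "p permutes {1..n}" "a \<in> {1..n}" "b \<in> {1..n}"
  shows "Transposition.transpose a b \<circ> p permutes {1..n}"
  using assms by (intro permutes_compose permutes_swap_id)

lemma ex_new_element: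
  assumes "finite S" "card S < n"
  obtains u where "u \<in> {1..n}" "u \<notin> S"
proof -
  have "\<not> {1..n} \<subseteq> S" using assms card_mono[of S "{1..n}"] by auto
  then show thesis using that by blast
qed

text \<open>A third point repairs the parity: (p q)(q r) is even and sends p to q.\<close>

lemma alt_group_transitive:
  assumes n: "3 \<le> n" and p: "p \<in> {1..n}" and q: "q \<in> {1..n}"
  obtains g where "g \<in> carrier (alt_group n)" "g p = q"
proof (cases "p = q")
  case True
  show thesis by (rule that[of id]) (auto simp: alt_group_carrier True permutes_id)
next
  case False
  obtain r where r: "r \<in> {1..n}" "r \<notin> {p, q}"
    using ex_new_element[of "{p, q}" n] n False by auto
  let ?g = "Transposition.transpose p q \<circ> Transposition.transpose q r"
  have "?g permutes {1..n}"
    using p q r by (intro alt_group_comp_transpose permutes_swap_id)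
  moreover have "evenperm ?g"
    using False r by (simp add: evenperm_comp_transpose permutation_swap_id evenperm_swap)
  ultimately show thesis using False r
    by (intro that[of ?g]) (auto simp: alt_group_carrier Transposition.transpose_def)
qed

lemma finite_alt_group: "finite (carrier (alt_group n))"
  by (rule finite_subset[OF _ finite_permutations[of "{1..n}"]]) (auto simp: alt_group_carrier)

text \<open>Product and unit are composition and \<open>id\<close> whatever the degree, so shrinking
  the carrier yields the smaller alternating group itself and not merely an isomorphic copy.\<close>

lemma alt_group_Suc_carrier_update: "(alt_group m)\<lparr>carrier := carrier (alt_group n)\<rparr> = alt_group n"
  by (simp add: alt_group_def sym_group_def)

lemma alt_group_subgroup_Suc: "subgroup (carrier (alt_group n)) (alt_group (Suc n))"
proof -
  interpret A: group "alt_group (Suc n)" by (rule alt_group_is_group)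
  interpret B: group "alt_group n" by (rule alt_group_is_group)
  have sub: "carrier (alt_group n) \<subseteq> carrier (alt_group (Suc n))"
    using permutes_subset[of _ "{1..n}" "{1..Suc n}"] by (auto simp: alt_group_carrier)
  show ?thesis
  proof (rule A.subgroupI[OF sub])
    show "carrier (alt_group n) \<noteq> {}" using B.one_closed by blast
  next
    fix a assume "a \<in> carrier (alt_group n)"
    then show "inv\<^bsub>alt_group (Suc n)\<^esub> a \<in> carrier (alt_group n)"
      using sub alt_group_inv_closed by (auto simp: alt_group_inv_equality)
  next
    fix a b assume "a \<in> carrier (alt_group n)" "b \<in> carrier (alt_group n)"
    then show "a \<otimes>\<^bsub>alt_group (Suc n)\<^esub> b \<in> carrier (alt_group n)"
      using B.m_closed[of a b] by (simp add: alt_group_mult)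
  qed
qed

text \<open>Permutations in the smaller group fix \<open>Suc n\<close>. If \<open>x\<close> moves
  \<open>p\<close>, conjugation by an even \<open>g\<close> that sends \<open>p\<close> to
  \<open>Suc n\<close> produces a permutation that moves \<open>Suc n\<close>.\<close>

lemma alt_group_core_free:
  assumes n: "2 \<le> n" and x: "x \<in> carrier (alt_group (Suc n))" "x \<noteq> id"
  obtains g where "g \<in> carrier (alt_group (Suc n))"
    "g \<otimes>\<^bsub>alt_group (Suc n)\<^esub> x \<otimes>\<^bsub>alt_group (Suc n)\<^esub> inv\<^bsub>alt_group (Suc n)\<^esub> g \<notin> carrier (alt_group n)"
proof -
  obtain p where p: "x p \<noteq> p" using x(2) by (auto simp: fun_eq_iff)
  then have pn: "p \<in> {1..Suc n}" using x(1) by (auto simp: alt_group_carrier permutes_def)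
  obtain g where g: "g \<in> carrier (alt_group (Suc n))" "g p = Suc n"
    using alt_group_transitive[of "Suc n" p "Suc n"] n pn by auto
  have bij: "bij g" using g(1) permutes_bij by (auto simp: alt_group_carrier)
  have "inv' g (Suc n) = p" using g(2) bij_is_inj[OF bij] by (metis inv_f_f)
  then have "(g \<circ> x \<circ> inv' g) (Suc n) = g (x p)" by simp
  also have "\<dots> \<noteq> Suc n" using p g(2) bij_is_inj[OF bij] by (metis injD)
  finally have "\<not> g \<circ> x \<circ> inv' g permutes {1..n}"
    using permutes_not_in[of "g \<circ> x \<circ> inv' g" "{1..n}" "Suc n"] by auto
  then have "g \<circ> x \<circ> inv' g \<notin> carrier (alt_group n)"
    by (simp only: alt_group_carrier) simp
  with g(1) show thesis
    by (intro that[of g]) (simp_all add: alt_group_mult alt_group_inv_equality)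
qed

lemma order_over_max_degree_alt_group_Suc:
  assumes "2 \<le> n"
  shows "order_over_max_degree (alt_group n) < order_over_max_degree (alt_group (Suc n))"
proof -
  interpret A: group "alt_group (Suc n)" by (rule alt_group_is_group)
  obtain g where "g \<in> carrier (alt_group (Suc n))" "g 1 = 2"
    using alt_group_transitive[of "Suc n" 1 2] assms by auto
  then have "carrier (alt_group (Suc n)) \<noteq> {\<one>\<^bsub>alt_group (Suc n)\<^esub>}"
    by (auto simp: alt_group_one)
  then have "order_over_max_degree ((alt_group (Suc n))\<lparr>carrier := carrier (alt_group n)\<rparr>) <
      order_over_max_degree (alt_group (Suc n))"
    using alt_group_core_free[OF assms]
    by (intro A.order_over_max_degree_less finite_alt_group alt_group_subgroup_Suc)
       (auto simp: alt_group_one)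
  then show ?thesis by (simp only: alt_group_Suc_carrier_update)
qed

lemma order_over_max_degree_alt_group_mono:
  assumes "m < n" "2 \<le> m"
  shows "order_over_max_degree (alt_group m) < order_over_max_degree (alt_group n)"
  using assms
proof (induction m n rule: less_Suc_induct)
  case (1 i)
  then show ?case by (intro order_over_max_degree_alt_group_Suc)
next
  case (2 i j k)
  then have "2 \<le> j" by simp
  with 2 show ?case by (meson less_trans)
qed

text \<open>Both are trivial, the transposition of two points being odd. This lets degree 1 be
  replaced by degree 2, where strict monotonicity starts.\<close>

lemma alt_group_1_eq_2: "alt_group 1 = alt_group 2"
proof -
  \<comment> \<open>The singleton is written as a doubleton with equal entries, so that one
    description of permutations covers both sets.\<close>
  have "{1..2::nat} = {1, 2}" "{1..1::nat} = {1, 1}" by auto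
  then have "p \<in> carrier (alt_group 2) \<longleftrightarrow> p = id" "p \<in> carrier (alt_group 1) \<longleftrightarrow> p = id" for p
    by (auto simp only: alt_group_carrier permutes_doubleton_iff evenperm_swap evenperm_id
        transpose_same)
  then have "carrier (alt_group 2) = carrier (alt_group 1)" by blast
  then show ?thesis by (simp add: alt_group_def sym_group_def)
qed

text \<open>Sends a to b, b to c and c to a when the points are distinct. It is the unfolded
  \<open>cycle_of_list [a, b, c]\<close>, the form in which the generators
  \<open>three_cycles\<close> are given.\<close>

definition cycle3 :: "nat \<Rightarrow> nat \<Rightarrow> nat \<Rightarrow> nat \<Rightarrow> nat" where
  "cycle3 a b c = Transposition.transpose a b \<circ> Transposition.transpose b c"

lemma cycle3_apply:
  assumes "distinct [a, b, c]"
  shows "cycle3 a b c x = (if x = a then b else if x = b then c else if x = c then a else x)"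
  using assms by (auto simp: cycle3_def Transposition.transpose_def)

lemma cycle3_in_alt_group:
  assumes "distinct [a, b, c]" "{a, b, c} \<subseteq> {1..n}"
  shows "cycle3 a b c \<in> carrier (alt_group n)"
proof -
  have "cycle3 a b c permutes {1..n}"
    unfolding cycle3_def using assms by (intro alt_group_comp_transpose permutes_swap_id) auto
  moreover have "evenperm (cycle3 a b c)"
    using assms(1) by (simp add: cycle3_def evenperm_comp_transpose permutation_swap_id evenperm_swap)
  ultimately show ?thesis by (simp add: alt_group_carrier)
qed

lemma conj_cycle3:
  assumes p: "bij p" and d: "distinct [a, b, c]"
  shows "p \<circ> cycle3 a b c \<circ> inv' p = cycle3 (p a) (p b) (p c)"
proof
  fix x
  have inj: "p u = p v \<longleftrightarrow> u = v" for u v using bij_is_inj[OF p] by (simp add: inj_eq)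
  obtain y where x: "x = p y" using p by (metis bij_pointE)
  have "inv' p x = y" using x bij_is_inj[OF p] by simp
  then show "(p \<circ> cycle3 a b c \<circ> inv' p) x = cycle3 (p a) (p b) (p c) x"
    using d by (simp add: cycle3_apply inj x)
qed

lemma inv_cycle3:
  assumes "distinct [a, b, c]"
  shows "inv' (cycle3 a b c) = cycle3 c b a"
proof (rule inv_unique_comp)
  show "cycle3 a b c \<circ> cycle3 c b a = id" "cycle3 c b a \<circ> cycle3 a b c = id"
    using assms by (auto simp: fun_eq_iff cycle3_apply)
qed

section \<open>Three-cycles in normal subgroups of alternating groups\<close>

context
  fixes n :: nat and N :: "(nat \<Rightarrow> nat) set"
  assumes N: "N \<lhd> alt_group n"
begin

lemma normal_alt_sub: "N \<subseteq> carrier (alt_group n)"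
  using N by (meson normal_imp_subgroup subgroup.subset)

lemma normal_alt_conj:
  assumes "s \<in> N" "t \<in> carrier (alt_group n)"
  shows "t \<circ> s \<circ> inv' t \<in> N"
proof -
  interpret A: group "alt_group n" by (rule alt_group_is_group)
  show ?thesis using A.normal_invE(2)[OF N assms(2,1)] assms(2)
    by (simp add: alt_group_mult alt_group_inv_equality)
qed

text \<open>The commutator s t s^-1 t^-1 with t = (a b c) lies in \<open>N\<close> when grouped as s
  (t s^-1 t^-1), and is a product of two three-cycles when grouped as (s t s^-1) t^-1. A good choice
  of t leaves few moved points.\<close>

lemma normal_alt_commutator:
  assumes s: "s \<in> N" and d: "distinct [a, b, c]" "{a, b, c} \<subseteq> {1..n}"
  shows "cycle3 (s a) (s b) (s c) \<circ> cycle3 c b a \<in> N"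
proof -
  interpret A: group "alt_group n" by (rule alt_group_is_group)
  have sub: "subgroup N (alt_group n)" using N by (rule normal_imp_subgroup)
  have sA: "s \<in> carrier (alt_group n)" using s normal_alt_sub by auto
  have bij: "bij s" using sA permutes_bij by (auto simp: alt_group_carrier)
  let ?t = "cycle3 a b c"
  have t: "?t \<in> carrier (alt_group n)" using d by (rule cycle3_in_alt_group)
  have "inv' s \<in> N"
    using subgroup.m_inv_closed[OF sub s] sA by (simp add: alt_group_inv_equality)
  then have mem: "s \<circ> (?t \<circ> inv' s \<circ> inv' ?t) \<in> N"
    using subgroup.m_closed[OF sub s] normal_alt_conj[OF _ t] by (simp add: alt_group_mult)
  have "s \<circ> (?t \<circ> inv' s \<circ> inv' ?t) = (s \<circ> ?t \<circ> inv' s) \<circ> inv' ?t"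
    by (simp add: comp_assoc)
  also have "\<dots> = cycle3 (s a) (s b) (s c) \<circ> cycle3 c b a"
    by (simp add: conj_cycle3[OF bij d(1)] inv_cycle3[OF d(1)])
  finally show ?thesis using mem by (simp only:)
qed

text \<open>With a -> b -> c -> e along the orbit of a, the commutator with (a b c) is (b c e)(c b
  a) = (a e b).\<close>

lemma normal_alt_long_cycle:
  assumes s: "s \<in> N" and a: "s a \<noteq> a" "s (s a) \<noteq> a" "s (s (s a)) \<noteq> a"
  shows "\<exists>x y z. distinct [x, y, z] \<and> {x, y, z} \<subseteq> {1..n} \<and> cycle3 x y z \<in> N"
proof -
  have perm: "s permutes {1..n}" using s normal_alt_sub by (auto simp: alt_group_carrier)
  have inj: "s u = s v \<longleftrightarrow> u = v" for u v using permutes_inj[OF perm] by (simp add: inj_eq)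
  have an: "a \<in> {1..n}" using a(1) perm by (metis permutes_not_in)
  then have in_n: "s a \<in> {1..n}" "s (s a) \<in> {1..n}" "s (s (s a)) \<in> {1..n}"
    by (metis permutes_in_image[OF perm])+
  define b c e where "b = s a" and "c = s b" and "e = s c"
  have dist: "distinct [a, b, c, e]"
    using a inj by (auto simp: b_def c_def e_def)
  have mem: "cycle3 (s a) (s b) (s c) \<circ> cycle3 c b a \<in> N"
    by (rule normal_alt_commutator[OF s]) (use dist an in_n in \<open>auto simp: b_def c_def\<close>)
  have "cycle3 (s a) (s b) (s c) \<circ> cycle3 c b a = cycle3 b c e \<circ> cycle3 c b a"
    by (simp add: b_def c_def e_def)
  also have "\<dots> = cycle3 a e b"
    using dist by (auto simp: fun_eq_iff cycle3_apply)
  finally have "cycle3 a e b \<in> N" using mem by (simp only:)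
  moreover have "distinct [a, e, b]" "{a, e, b} \<subseteq> {1..n}"
    using dist an in_n by (auto simp: b_def c_def e_def)
  ultimately show ?thesis by blast
qed

lemma normal_alt_has_cycle3:
  assumes n: "5 \<le> n" and s: "s \<in> N" "s \<noteq> id"
  shows "\<exists>x y z. distinct [x, y, z] \<and> {x, y, z} \<subseteq> {1..n} \<and> cycle3 x y z \<in> N"
proof -
  have perm: "s permutes {1..n}" and even: "evenperm s"
    using s normal_alt_sub by (auto simp: alt_group_carrier)
  have inj: "s u = s v \<longleftrightarrow> u = v" for u v using permutes_inj[OF perm] by (simp add: inj_eq)
  have moved: "u \<in> {1..n}" "s u \<in> {1..n}" if "s u \<noteq> u" for u
    using that perm permutes_in_image[OF perm] by (metis permutes_not_in)+
  \<comment> \<open>Orbit lengths: some orbit has length at least 4, some has length 3, or none is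
    longer than 2.\<close>
  consider (long) a where "s a \<noteq> a" "s (s a) \<noteq> a" "s (s (s a)) \<noteq> a"
    | (three) a where "s a \<noteq> a" "s (s a) \<noteq> a" "s (s (s a)) = a"
    | (two) "\<And>u. s (s u) = u"
    by metis
  then show ?thesis
  proof cases
    case long
    then show ?thesis by (rule normal_alt_long_cycle[OF s(1)])
  next
    case (three a)
    define b c where "b = s a" and "c = s b"
    have dist: "distinct [a, b, c]" using three inj by (auto simp: b_def c_def)
    have sc: "s c = a" using three by (simp add: b_def c_def)
    have abc: "{a, b, c} \<subseteq> {1..n}"
      using moved(1)[of a] moved(1)[of b] moved(1)[of c] dist sc by (auto simp: b_def c_def)
    show ?thesis
    proof (cases "s = cycle3 a b c")
      case True
      then show ?thesis using dist abc s(1) by blast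
    next
      case False
      then obtain e where e: "s e \<noteq> cycle3 a b c e" by (auto simp: fun_eq_iff)
      have eabc: "e \<notin> {a, b, c}"
        using e dist sc by (auto simp: cycle3_apply b_def c_def)
      then have se: "s e \<noteq> e" using e dist by (simp add: cycle3_apply)
      define f where "f = s e"
      have fabc: "f \<notin> {a, b, c}"
        using eabc inj[of e a] inj[of e b] inj[of e c] sc by (auto simp: f_def b_def c_def)
      have ef: "e \<in> {1..n}" "f \<in> {1..n}" using moved[OF se] by (auto simp: f_def)
      \<comment> \<open>The commutator with (a b e), where \<open>e\<close> is a further moved
        point. It runs b -> a -> e -> c, so it has an orbit of length at least 4.\<close>
      let ?p = "cycle3 b c f \<circ> cycle3 e b a"
      have "cycle3 (s a) (s b) (s e) \<circ> cycle3 e b a \<in> N"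
        using dist eabc abc ef by (intro normal_alt_commutator[OF s(1)]) auto
      then have "?p \<in> N" by (simp add: b_def c_def f_def)
      moreover have "?p b = a" "?p a = e" "?p e = c"
        using dist eabc fabc se by (auto simp: cycle3_apply f_def)
      ultimately show ?thesis
        using dist eabc by (intro normal_alt_long_cycle[of ?p b]) auto
    qed
  next
    case two
    obtain a where a: "s a \<noteq> a" using s(2) by (auto simp: fun_eq_iff)
    define b where "b = s a"
    have ab: "a \<noteq> b" "s a = b" "s b = a" "a \<in> {1..n}" "b \<in> {1..n}"
      using a two moved[OF a] by (auto simp: b_def)
    \<comment> \<open>A single transposition is odd, so \<open>s\<close> has a second two-cycle,
      named (c e) below.\<close>
    have "s \<noteq> Transposition.transpose a b" using even ab(1) by (auto simp: evenperm_swap)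
    then obtain c where c: "s c \<noteq> Transposition.transpose a b c" by (auto simp: fun_eq_iff)
    then have cab: "c \<notin> {a, b}" using ab by auto
    then have sc: "s c \<noteq> c" using c by (auto simp: Transposition.transpose_def split: if_splits)
    define e where "e = s c"
    have eab: "e \<notin> {a, b}" using cab ab inj[of c a] inj[of c b] by (auto simp: e_def)
    have ce: "c \<noteq> e" "c \<in> {1..n}" "e \<in> {1..n}" using sc moved[OF sc] by (auto simp: e_def)
    \<comment> \<open>This commutator with (a b c) is the double transposition (a c)(b e).\<close>
    let ?q = "cycle3 b a e \<circ> cycle3 c b a"
    have "cycle3 (s a) (s b) (s c) \<circ> cycle3 c b a \<in> N"
      using cab ab ce by (intro normal_alt_commutator[OF s(1)]) auto
    then have q: "?q \<in> N" by (simp add: ab e_def)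
    \<comment> \<open>A fifth point, available from \<open>5 \<le> n\<close>. It is fixed by
      \<open>?q\<close>, so the commutator of \<open>?q\<close> with (a c f) is the square of the
      three-cycle (c a f).\<close>
    obtain f where f: "f \<in> {1..n}" "f \<notin> {a, b, c, e}"
      using ex_new_element[of "{a, b, c, e}" n] n card_length[of "[a, b, c, e]"] by auto
    have qv: "?q a = c" "?q c = a" "?q f = f"
      using cab eab ab ce f by (auto simp: cycle3_apply)
    have "cycle3 (?q a) (?q c) (?q f) \<circ> cycle3 f c a \<in> N"
      using cab f ab ce by (intro normal_alt_commutator[OF q]) auto
    moreover have "cycle3 c a f \<circ> cycle3 f c a = cycle3 f a c"
      using cab f by (auto simp: fun_eq_iff cycle3_apply)
    ultimately have "cycle3 f a c \<in> N" by (simp only: qv)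
    moreover have "distinct [f, a, c]" "{f, a, c} \<subseteq> {1..n}"
      using cab f ab ce by auto
    ultimately show ?thesis by blast
  qed
qed

end

text \<open>Three transpositions carry a, b, c to their targets one after another, each leaving the
  earlier targets in place. If the result is odd, a transposition of two points outside the targets
  corrects the parity; this takes five points.\<close>

lemma alt_group_ex_map3:
  assumes n: "5 \<le> n" and abc: "distinct [a, b, c]" "{a, b, c} \<subseteq> {1..n}"
    and xyz: "distinct [x, y, z]" "{x, y, z} \<subseteq> {1..n}"
  obtains g where "g \<in> carrier (alt_group n)" "g a = x" "g b = y" "g c = z"
proof -
  define p where "p = Transposition.transpose a x"
  define q where "q = Transposition.transpose (p b) y \<circ> p"
  define r where "r = Transposition.transpose (q c) z \<circ> q"
  have p: "p permutes {1..n}" "p a = x"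
    using abc xyz by (auto simp: p_def intro: permutes_swap_id)
  have pb: "p b \<in> {1..n}" "p b \<noteq> x"
    using abc p permutes_in_image[OF p(1)] permutes_inj[OF p(1)] by (auto simp: inj_eq dest: injD)
  have q: "q permutes {1..n}"
    unfolding q_def using p pb xyz by (intro alt_group_comp_transpose) auto
  have qv: "q a = x" "q b = y"
    using p pb xyz by (auto simp: q_def)
  have qc: "q c \<in> {1..n}" "q c \<noteq> x" "q c \<noteq> y"
    using abc qv permutes_in_image[OF q] permutes_inj[OF q] by (auto dest: injD)
  have r: "r permutes {1..n}"
    unfolding r_def using q qc xyz by (intro alt_group_comp_transpose) auto
  have rv: "r a = x" "r b = y" "r c = z"
    using qv qc xyz by (auto simp: r_def)
  show thesis
  proof (cases "evenperm r")
    case True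
    then show thesis using r rv by (intro that[of r]) (auto simp: alt_group_carrier)
  next
    case False
    have "card {x, y, z} < n" using n card_length[of "[x, y, z]"] by simp
    then obtain u where u: "u \<in> {1..n}" "u \<notin> {x, y, z}"
      by (rule ex_new_element[rotated]) auto
    have "card {x, y, z, u} < n" using n card_length[of "[x, y, z, u]"] by simp
    then obtain v where v: "v \<in> {1..n}" "v \<notin> {x, y, z, u}"
      by (rule ex_new_element[rotated]) auto
    let ?g = "Transposition.transpose u v \<circ> r"
    have "permutation r" using r permutation_permutes by blast
    then have "evenperm ?g" using False v by (simp add: evenperm_comp_transpose)
    moreover have "?g permutes {1..n}" using r u v by (intro alt_group_comp_transpose)
    ultimately show thesis using r rv u v
      by (intro that[of ?g]) (auto simp: alt_group_carrier Transposition.transpose_def)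
  qed
qed

text \<open>A nonidentity element forces some three-cycle into \<open>N\<close>; even permutations
  conjugate it to every other three-cycle, and these generate the group.\<close>

lemma alt_group_simple:
  assumes n: "5 \<le> n" and N: "N \<lhd> alt_group n"
  shows "N = {id} \<or> N = carrier (alt_group n)"
proof (rule disjCI)
  assume "N \<noteq> carrier (alt_group n)"
  interpret A: group "alt_group n" by (rule alt_group_is_group)
  have sub: "subgroup N (alt_group n)" using N by (rule normal_imp_subgroup)
  have idN: "id \<in> N" using subgroup.one_closed[OF sub] by (simp add: alt_group_one)
  show "N = {id}"
  proof (rule ccontr)
    assume "N \<noteq> {id}"
    then obtain s where "s \<in> N" "s \<noteq> id" using idN by auto
    from normal_alt_has_cycle3[OF N n this] obtain a b c
      where abc: "distinct [a, b, c]" "{a, b, c} \<subseteq> {1..n}" "cycle3 a b c \<in> N" by blast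
    have "three_cycles n \<subseteq> N"
    proof
      fix p assume "p \<in> three_cycles n"
      then obtain cs where cs: "p = cycle_of_list cs" "distinct cs" "length cs = 3" "set cs \<subseteq> {1..n}"
        by auto
      then obtain x y z where xyz: "cs = [x, y, z]" using stupid_lemma by blast
      have p: "p = cycle3 x y z" by (simp add: cs(1) xyz cycle3_def)
      obtain g where g: "g \<in> carrier (alt_group n)" "g a = x" "g b = y" "g c = z"
        by (rule alt_group_ex_map3[OF n abc(1,2), of x y z]) (use cs xyz in auto)
      have "bij g" using g(1) permutes_bij by (auto simp: alt_group_carrier)
      from conj_cycle3[OF this abc(1)] normal_alt_conj[OF N abc(3) g(1)]
      show "p \<in> N" by (simp add: p g)
    qed
    then have "generate (alt_group n) (three_cycles n) \<subseteq> N"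
      by (rule A.generate_subgroup_incl[OF _ sub])
    with \<open>N \<noteq> carrier (alt_group n)\<close> show False
      using subgroup.subset[OF sub] by (auto simp: alt_group_carrier_as_three_cycles)
  qed
qed

text \<open>The permutation matrix of the action on \<open>{1..n}\<close>; matrix indices start at
  0, hence the shift by \<open>Suc\<close>.\<close>

definition perm_mat :: "nat \<Rightarrow> (nat \<Rightarrow> nat) \<Rightarrow> complex mat" where
  "perm_mat n s = mat n n (\<lambda>(i, j). if s (Suc j) = Suc i then 1 else 0)"

lemma perm_mat_rep: "matrix_rep (alt_group n) n (perm_mat n)"
proof -
  interpret A: group "alt_group n" by (rule alt_group_is_group)
  show ?thesis
  proof unfold_locales
    fix g h assume "g \<in> carrier (alt_group n)" and h: "h \<in> carrier (alt_group n)"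
    have hp: "h permutes {1..n}" using h by (simp add: alt_group_carrier)
    show "perm_mat n (g \<otimes>\<^bsub>alt_group n\<^esub> h) = perm_mat n g * perm_mat n h"
    proof (rule eq_matI)
      fix i j assume "i < dim_row (perm_mat n g * perm_mat n h)" "j < dim_col (perm_mat n g * perm_mat n h)"
      then have ij: "i < n" "j < n" by (auto simp: perm_mat_def)
      have "h (Suc j) \<in> {1..n}" using ij permutes_in_image[OF hp, of "Suc j"] by auto
      then obtain k where k: "h (Suc j) = Suc k" "k < n" by (cases "h (Suc j)") auto
      have "(perm_mat n g * perm_mat n h) $$ (i, j) =
          (\<Sum>l<n. (if g (Suc l) = Suc i then 1 else 0) * (if k = l then 1 else 0))"
        using ij k(1) by (auto simp: perm_mat_def scalar_prod_def atLeast0LessThan intro!: sum.cong)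
      also have "\<dots> = (\<Sum>l<n. if k = l then (if g (Suc l) = Suc i then 1 else 0) else 0)"
        by (intro sum.cong) auto
      also have "\<dots> = (if g (Suc k) = Suc i then 1 else 0)" using k(2) by simp
      finally show "perm_mat n (g \<otimes>\<^bsub>alt_group n\<^esub> h) $$ (i, j) = (perm_mat n g * perm_mat n h) $$ (i, j)"
        using ij k by (simp add: perm_mat_def alt_group_mult)
    qed (auto simp: perm_mat_def)
  qed (auto simp: perm_mat_def alt_group_one)
qed

text \<open>An irreducible submodule is taken among the vectors of coordinate sum 0 in the
  permutation module. It is nontrivial, because a vector fixed by a transitive group is constant,
  and a constant vector of sum 0 vanishes.\<close>

lemma alt_group_nontrivial_irr_rep:
  assumes n: "3 \<le> n"
  obtains k \<sigma> x where "irr_rep (alt_group n) k \<sigma>" "x \<in> carrier (alt_group n)" "\<sigma> x \<noteq> 1\<^sub>m k"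
proof -
  interpret P: matrix_rep "alt_group n" n "perm_mat n" by (rule perm_mat_rep)
  define E where "E = {v \<in> carrier_vec n. (\<Sum>i<n. v $ i) = (0::complex)}"
  have E: "lin_subspace n E"
    by (auto simp: lin_subspace_def E_def sum.distrib simp flip: sum_distrib_left)
  have Pv: "(perm_mat n g *\<^sub>v v) $ i = (\<Sum>j<n. if g (Suc j) = Suc i then v $ j else 0)"
    if "v \<in> carrier_vec n" "i < n" for g v i
    using that by (auto simp: perm_mat_def scalar_prod_def atLeast0LessThan intro!: sum.cong)
  have E_stable: "P.stable E"
    unfolding P.stable_def
  proof (intro ballI)
    fix g v assume g: "g \<in> carrier (alt_group n)" and v: "v \<in> E"
    have gp: "g permutes {1..n}" using g by (simp add: alt_group_carrier)
    have vn: "v \<in> carrier_vec n" using v by (simp add: E_def)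
    have "(\<Sum>i<n. (perm_mat n g *\<^sub>v v) $ i) = (\<Sum>j<n. \<Sum>i<n. if g (Suc j) = Suc i then v $ j else 0)"
      by (subst sum.swap) (simp add: Pv[OF vn] del: index_mult_mat_vec)
    also have "\<dots> = (\<Sum>j<n. v $ j)"
    proof (rule sum.cong)
      fix j assume "j \<in> {..<n}"
      then have "g (Suc j) \<in> {1..n}" using permutes_in_image[OF gp, of "Suc j"] by auto
      then obtain k where k: "g (Suc j) = Suc k" "k < n" by (cases "g (Suc j)") auto
      then show "(\<Sum>i<n. if g (Suc j) = Suc i then v $ j else 0) = v $ j" by simp
    qed simp
    finally show "perm_mat n g *\<^sub>v v \<in> E"
      using v P.rho_vec_carrier[OF g vn] by (simp add: E_def)
  qed
  \<comment> \<open>The difference of two basis vectors, a nonzero vector of sum 0.\<close>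
  define w where "w = vec n (\<lambda>i. if i = 0 then 1 else if i = 1 then - 1 else (0::complex))"
  have "(\<Sum>i<n. w $ i) = (\<Sum>i<n. (if i = 0 then 1 else 0) + (if i = 1 then - 1 else 0))"
    by (intro sum.cong) (auto simp: w_def)
  also have "\<dots> = 0" unfolding sum.distrib using n by simp
  finally have "w \<in> E" by (simp add: E_def w_def)
  moreover have "w $ 0 \<noteq> 0\<^sub>v n $ 0" using n by (simp add: w_def)
  ultimately have E_nz: "E \<noteq> {0\<^sub>v n}" by auto
  obtain k B \<sigma> where B: "B \<in> carrier_mat n k" "injective_mat B" "0 < k" "mat_range B \<subseteq> E"
    and \<sigma>: "irr_rep (alt_group n) k \<sigma>"
      "\<And>g. g \<in> carrier (alt_group n) \<Longrightarrow> perm_mat n g * B = B * \<sigma> g"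
    by (rule P.irreducible_subrep[OF E E_stable E_nz]) (rule that)
  have "\<exists>x\<in>carrier (alt_group n). \<sigma> x \<noteq> 1\<^sub>m k"
  proof (rule ccontr)
    assume "\<not> ?thesis"
    then have triv: "\<sigma> g = 1\<^sub>m k" if "g \<in> carrier (alt_group n)" for g using that by blast
    define u where "u = B *\<^sub>v unit_vec k 0"
    have u0: "u \<noteq> 0\<^sub>v n" using injective_matD[OF B(2,1), of "unit_vec k 0"] B(3) by (auto simp: u_def)
    have "u \<in> mat_range B"
      unfolding mat_range_iff[OF B(1)] u_def by (rule bexI[of _ "unit_vec k 0"]) simp_all
    then have uE: "u \<in> E" using B(4) by auto
    then have un: "u \<in> carrier_vec n" by (simp add: E_def)
    have fixed: "perm_mat n g *\<^sub>v u = u" if g: "g \<in> carrier (alt_group n)" for g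
    proof -
      have "perm_mat n g *\<^sub>v u = (perm_mat n g * B) *\<^sub>v unit_vec k 0"
        unfolding u_def using P.rho_carrier[OF g] B(1) by (intro assoc_mult_mat_vec[symmetric]) auto
      also have "perm_mat n g * B = B"
        using \<sigma>(2)[OF g] triv[OF g] right_mult_one_mat[OF B(1)] by simp
      finally show ?thesis by (simp add: u_def)
    qed
    have const: "u $ i = u $ 0" if i: "i < n" for i
    proof -
      obtain g where g: "g \<in> carrier (alt_group n)" "g (Suc 0) = Suc i"
        using alt_group_transitive[OF n, of "Suc 0" "Suc i"] i n by auto
      have "inj g" using g(1) permutes_inj by (auto simp: alt_group_carrier)
      \<comment> \<open>Row i of the matrix of \<open>g\<close> thus has its only entry 1 in column
        0 and picks out coordinate 0.\<close>
      then have gj: "g (Suc j) = Suc i \<longleftrightarrow> j = 0" for j using g(2) by (metis injD old.nat.inject)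
      have "u $ i = (perm_mat n g *\<^sub>v u) $ i" by (simp only: fixed[OF g(1)])
      also have "\<dots> = u $ 0" using n by (simp add: Pv[OF un i] gj del: index_mult_mat_vec)
      finally show ?thesis .
    qed
    have "(\<Sum>i<n. u $ i) = (\<Sum>i<n. u $ 0)" by (intro sum.cong refl const) simp
    then have "(\<Sum>i<n. u $ i) = of_nat n * u $ 0" by simp
    with uE n have "u $ 0 = 0" by (simp add: E_def)
    have "u $ i = 0" if "i < n" for i using const[OF that] \<open>u $ 0 = 0\<close> by (rule trans)
    then have "u = 0\<^sub>v n" using un by (intro eq_vecI) auto
    with u0 show False ..
  qed
  with \<sigma>(1) show thesis using that by blast
qed

text \<open>The excluded cases are genuine exceptions: A_1 and A_2 are both trivial, and the sets of
  codegrees for degrees 1 to 4 are {1}, {1}, {1, 3} and {1, 3, 4}. From m = 4 on, A_(m+1) is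
  simple.\<close>

theorem proposition8p1:
  fixes m n :: nat
  assumes "0 < m" and "m < n"
  shows "((m, n) \<noteq> (1, 2) \<longrightarrow>
            order_over_max_degree (alt_group m) < order_over_max_degree (alt_group n)) \<and>
         (m \<notin> {1, 2, 3} \<longrightarrow>
            \<not> codegrees (alt_group m) \<subseteq> codegrees (alt_group (m + 1)))"
proof (intro conjI impI)
  assume mn: "(m, n) \<noteq> (1, 2)"
  show "order_over_max_degree (alt_group m) < order_over_max_degree (alt_group n)"
  proof (cases "m = 1")
    case True
    then have "2 < n" using mn assms by auto
    then show ?thesis
      unfolding True alt_group_1_eq_2 by (intro order_over_max_degree_alt_group_mono) auto
  next
    case False
    then show ?thesis using assms by (intro order_over_max_degree_alt_group_mono) auto
  qed
next
  assume "m \<notin> {1, 2, 3}"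
  then have m: "4 \<le> m" using assms by auto
  interpret A: group "alt_group m" by (rule alt_group_is_group)
  interpret B: group "alt_group (m + 1)" by (rule alt_group_is_group)
  obtain k \<sigma> x where "irr_rep (alt_group m) k \<sigma>" "x \<in> carrier (alt_group m)" "\<sigma> x \<noteq> 1\<^sub>m k"
    using alt_group_nontrivial_irr_rep[of m] m by auto
  from A.small_codegree_exists[OF finite_alt_group this]
  obtain c where c: "c \<in> codegrees (alt_group m)" "1 < c" "c \<le> order_over_max_degree (alt_group m)"
    by blast
  have "order_over_max_degree (alt_group m) < order_over_max_degree (alt_group (m + 1))"
    using m by (intro order_over_max_degree_alt_group_mono) auto
  with c(3) have "c < order_over_max_degree (alt_group (m + 1))" by (rule le_less_trans)
  moreover have "N = {\<one>\<^bsub>alt_group (m + 1)\<^esub>} \<or> N = carrier (alt_group (m + 1))"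
    if "N \<lhd> alt_group (m + 1)" for N
    using alt_group_simple[OF _ that] m by (simp add: alt_group_one)
  ultimately have "c \<notin> codegrees (alt_group (m + 1))"
    using B.codegree_simple_ge[OF finite_alt_group, of c] c(2) by fastforce
  with c(1) show "\<not> codegrees (alt_group m) \<subseteq> codegrees (alt_group (m + 1))" by blast
qed

end
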